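(* The constructions $\otimes$ and $(-)^{\partial}$, together with the object $\mathbb{I}$, make $\mathbf{Pol}$ a $*$-autonomous category.
   Context: For a binary relation $R\subseteq A\times B$ between sets, $R^{\intercal}\subseteq B\times A$ is its converse, and antitone maps $R^{\downarrow}:\mathcal{P}(B)\to\mathcal{P}(A)$ and $R^{\uparrow}:\mathcal{P}(A)\to\mathcal{P}(B)$ are defined by $R^{\downarrow}(Y)=\{a\in A\mid a\mathrel{R}\beta\text{ for all }\beta\in Y\}$ and $R^{\uparrow}(X)=\{\beta\in B\mid a\mathrel{R}\beta\text{ for all }a\in X\}$. Juxtaposition of such maps denotes composition, the rightmost map being applied first. A polarity $\mathcal{A}=(A^-,A^+;\mathcal{A})$ consists of two sets $A^-,A^+$ and a binary relation $\mathcal{A}\subseteq A^-\times A^+$ (its incidence relation, denoted by the same letter). Put $\mathrm{cl}_{\mathcal{A}}=\mathcal{A}^{\downarrow}\mathcal{A}^{\uparrow}$ on $\mathcal{P}(A^-)$ and $\mathrm{cl}^{\mathcal{A}}=\mathcal{A}^{\uparrow}\mathcal{A}^{\downarrow}$ on $\mathcal{P}(A^+)$. For polarities $\mathcal{A},\mathcal{B}$, a relation $R\subseteq A^-\times B^+$ is a compatible relation from $\mathcal{A}$ to $\mathcal{B}$ if $\mathrm{cl}_{\mathcal{A}}R^{\downarrow}=R^{\downarrow}$ (compatibility with $\mathcal{A}$ on the left) and $R^{\downarrow}\mathrm{cl}^{\mathcal{B}}=R^{\downarrow}$ (compatibility with $\mathcal{B}$ on the right). $\mathbf{Pol}$ is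 the category whose objects are polarities and whose morphisms $\mathcal{A}\to\mathcal{B}$ are the compatible relations from $\mathcal{A}$ to $\mathcal{B}$. The composite of $R:\mathcal{A}\to\mathcal{B}$ and $S:\mathcal{B}\to\mathcal{C}$ (written in diagrammatic order) is the relation $R\mathbin{;}S\subseteq A^-\times C^+$ with $a\mathrel{(R\mathbin{;}S)}\gamma$ if and only if $a\in R^{\downarrow}\mathcal{B}^{\uparrow}S^{\downarrow}(\{\gamma\})$. The identity on $\mathcal{A}$ is its incidence relation. Duality: $\mathcal{A}^{\partial}=(A^+,A^-;\mathcal{A}^{\intercal})$ on objects and $R^{\partial}=R^{\intercal}:\mathcal{B}^{\partial}\to\mathcal{A}^{\partial}$ for a morphism $R:\mathcal{A}\to\mathcal{B}$; this is a contravariant endofunctor of $\mathbf{Pol}$. Tensor: a subset $T\subseteq A^-\times B^-$ is stable if it is compatible with $\mathcal{A}$ on the left and with $\mathcal{B}^{\partial}$ on the right; equivalently, for all $X\subseteq A^-$ and $Y\subseteq B^-$, $X\times Y\subseteq T$ implies $\mathrm{cl}_{\mathcal{A}}(X)\times\mathrm{cl}_{\mathcal{B}}(Y)\subseteq T$. Stable subsets are closed under arbitrary intersection; $s(T)$ denotes the smallest stable subset containing $T$. The polarity $\mathcal{A}\otimes\mathcal{B}$ has $(\mathcal{A}\otimes\mathcal{B})^-=A^-\times B^-$, $(\mathcal{A}\otimes\mathcal{B})^+=\mathcal{P}(A^-\times B^-)$, and $(a,b)\mathrel{(\mathcal{A}\otimes\mathcal{B})}T$ if and only if $(a,b)\in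 s(T)$. For morphisms $Q:\mathcal{A}\to\mathcal{B}$ and $S:\mathcal{C}\to\mathcal{D}$, the relation $Q\otimes S\subseteq(A^-\times C^-)\times\mathcal{P}(B^-\times D^-)$ is given by $(a,c)\mathrel{(Q\otimes S)}R$ if and only if $a\mathrel{(Q\mathbin{;}s(R)\mathbin{;}S^{\partial})}c$, where $s(R)$ is regarded as a morphism $\mathcal{B}\to\mathcal{D}^{\partial}$. Unit: $\mathbb{I}=(\{\bullet\},\{\bullet\};\emptyset)$. A $*$-autonomous category is a symmetric monoidal category $\mathbf{A}$ (with tensor $\otimes$) possessing a contravariant functor ${}^{*}$ with bijections $\mathbf{A}(A\otimes B,C^{*})\simeq\mathbf{A}(A,(B\otimes C)^{*})$ natural in $A,B,C$. Here the contravariant functor is $(-)^{\partial}$. *)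

theory Defs
  imports Main "HOL-Library.Nat_Bijection"
begin

section \<open>Categories\<close>

text \<open>Composition is written in diagrammatic order throughout.\<close>

record ('o, 'm) cat =
  Obj :: "'o set"
  Arr :: "'m set"
  src :: "'m \<Rightarrow> 'o"
  tgt :: "'m \<Rightarrow> 'o"
  idn :: "'o \<Rightarrow> 'm"
  comp :: "'m \<Rightarrow> 'm \<Rightarrow> 'm"  (infixl \<open>;;\<index>\<close> 70)

definition Hom :: "('o, 'm, 'x) cat_scheme \<Rightarrow> 'o \<Rightarrow> 'o \<Rightarrow> 'm set" where
  "Hom C A B = {f \<in> Arr C. src C f = A \<and> tgt C f = B}"

locale category =
  fixes C :: "('o, 'm, 'x) cat_scheme" (structure)
  assumes src_obj: "f \<in> Arr C \<Longrightarrow> src C f \<in> Obj C"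
    and tgt_obj: "f \<in> Arr C \<Longrightarrow> tgt C f \<in> Obj C"
    and idn_hom: "A \<in> Obj C \<Longrightarrow> idn C A \<in> Hom C A A"
    and comp_hom: "f \<in> Hom C A B \<Longrightarrow> g \<in> Hom C B D \<Longrightarrow> f ;; g \<in> Hom C A D"
    and idn_left: "f \<in> Hom C A B \<Longrightarrow> idn C A ;; f = f"
    and idn_right: "f \<in> Hom C A B \<Longrightarrow> f ;; idn C B = f"
    and comp_assoc: "f \<in> Hom C A B \<Longrightarrow> g \<in> Hom C B D \<Longrightarrow> h \<in> Hom C D E
      \<Longrightarrow> (f ;; g) ;; h = f ;; (g ;; h)"

definition iso_in :: "('o, 'm, 'x) cat_scheme \<Rightarrow> 'o \<Rightarrow> 'o \<Rightarrow> 'm \<Rightarrow> bool" where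
  "iso_in C A B f \<longleftrightarrow> f \<in> Hom C A B \<and>
     (\<exists>g \<in> Hom C B A. f ;;\<^bsub>C\<^esub> g = idn C A \<and> g ;;\<^bsub>C\<^esub> f = idn C B)"

locale contravariant_endofunctor = category C
  for C :: "('o, 'm, 'x) cat_scheme" (structure) +
  fixes star :: "'o \<Rightarrow> 'o" and starA :: "'m \<Rightarrow> 'm"
  assumes star_obj: "A \<in> Obj C \<Longrightarrow> star A \<in> Obj C"
    and starA_hom: "f \<in> Hom C A B \<Longrightarrow> starA f \<in> Hom C (star B) (star A)"
    and starA_idn: "A \<in> Obj C \<Longrightarrow> starA (idn C A) = idn C (star A)"
    and starA_comp: "f \<in> Hom C A B \<Longrightarrow> g \<in> Hom C B D \<Longrightarrow> starA (f ;; g) = starA g ;; starA f"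

locale monoidal_category = category C
  for C :: "('o, 'm, 'x) cat_scheme" (structure) +
  fixes ten :: "'o \<Rightarrow> 'o \<Rightarrow> 'o"  (infixr \<open>\<otimes>\<close> 75)
    and tenA :: "'m \<Rightarrow> 'm \<Rightarrow> 'm"  (infixr \<open>\<boxtimes>\<close> 75)
    and unit :: 'o
    and ass :: "'o \<Rightarrow> 'o \<Rightarrow> 'o \<Rightarrow> 'm"
    and lun :: "'o \<Rightarrow> 'm"
    and run :: "'o \<Rightarrow> 'm"
  assumes ten_obj: "A \<in> Obj C \<Longrightarrow> B \<in> Obj C \<Longrightarrow> A \<otimes> B \<in> Obj C"
    and tenA_hom: "f \<in> Hom C A B \<Longrightarrow> g \<in> Hom C A' B' \<Longrightarrow> f \<boxtimes> g \<in> Hom C (A \<otimes> A') (B \<otimes> B')"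
    and tenA_idn: "A \<in> Obj C \<Longrightarrow> B \<in> Obj C \<Longrightarrow> idn C A \<boxtimes> idn C B = idn C (A \<otimes> B)"
    and tenA_comp: "f \<in> Hom C A B \<Longrightarrow> g \<in> Hom C B D
      \<Longrightarrow> f' \<in> Hom C A' B' \<Longrightarrow> g' \<in> Hom C B' D'
      \<Longrightarrow> (f ;; g) \<boxtimes> (f' ;; g') = (f \<boxtimes> f') ;; (g \<boxtimes> g')"
    and unit_obj: "unit \<in> Obj C"
    and ass_iso: "A \<in> Obj C \<Longrightarrow> B \<in> Obj C \<Longrightarrow> D \<in> Obj C
      \<Longrightarrow> iso_in C ((A \<otimes> B) \<otimes> D) (A \<otimes> (B \<otimes> D)) (ass A B D)"
    and ass_natural: "f \<in> Hom C A A' \<Longrightarrow> g \<in> Hom C B B' \<Longrightarrow> h \<in> Hom C D D'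
      \<Longrightarrow> ((f \<boxtimes> g) \<boxtimes> h) ;; ass A' B' D' = ass A B D ;; (f \<boxtimes> (g \<boxtimes> h))"
    and lun_iso: "A \<in> Obj C \<Longrightarrow> iso_in C (unit \<otimes> A) A (lun A)"
    and lun_natural: "f \<in> Hom C A B \<Longrightarrow> (idn C unit \<boxtimes> f) ;; lun B = lun A ;; f"
    and run_iso: "A \<in> Obj C \<Longrightarrow> iso_in C (A \<otimes> unit) A (run A)"
    and run_natural: "f \<in> Hom C A B \<Longrightarrow> (f \<boxtimes> idn C unit) ;; run B = run A ;; f"
    and pentagon: "A \<in> Obj C \<Longrightarrow> B \<in> Obj C \<Longrightarrow> D \<in> Obj C \<Longrightarrow> E \<in> Obj C
      \<Longrightarrow> ass (A \<otimes> B) D E ;; ass A B (D \<otimes> E)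
        = (ass A B D \<boxtimes> idn C E) ;; ass A (B \<otimes> D) E ;; (idn C A \<boxtimes> ass B D E)"
    and triangle: "A \<in> Obj C \<Longrightarrow> B \<in> Obj C
      \<Longrightarrow> ass A unit B ;; (idn C A \<boxtimes> lun B) = run A \<boxtimes> idn C B"

locale symmetric_monoidal_category = monoidal_category C ten tenA unit ass lun run
  for C :: "('o, 'm, 'x) cat_scheme" (structure)
    and ten :: "'o \<Rightarrow> 'o \<Rightarrow> 'o"  (infixr \<open>\<otimes>\<close> 75)
    and tenA :: "'m \<Rightarrow> 'm \<Rightarrow> 'm"  (infixr \<open>\<boxtimes>\<close> 75)
    and unit ass lun run +
  fixes sym :: "'o \<Rightarrow> 'o \<Rightarrow> 'm"
  assumes sym_hom: "A \<in> Obj C \<Longrightarrow> B \<in> Obj C \<Longrightarrow> sym A B \<in> Hom C (A \<otimes> B) (B \<otimes> A)"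
    and sym_natural: "f \<in> Hom C A A' \<Longrightarrow> g \<in> Hom C B B'
      \<Longrightarrow> (f \<boxtimes> g) ;; sym A' B' = sym A B ;; (g \<boxtimes> f)"
    and sym_inverse: "A \<in> Obj C \<Longrightarrow> B \<in> Obj C \<Longrightarrow> sym A B ;; sym B A = idn C (A \<otimes> B)"
    and sym_unit: "A \<in> Obj C \<Longrightarrow> sym A unit ;; lun A = run A"
    and hexagon: "A \<in> Obj C \<Longrightarrow> B \<in> Obj C \<Longrightarrow> D \<in> Obj C
      \<Longrightarrow> ass A B D ;; sym A (B \<otimes> D) ;; ass B D A
        = (sym A B \<boxtimes> idn C D) ;; ass B A D ;; (idn C B \<boxtimes> sym A D)"

locale star_autonomous_category =
  symmetric_monoidal_category C ten tenA unit ass lun run sym +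
  contravariant_endofunctor C star starA
  for C :: "('o, 'm, 'x) cat_scheme" (structure)
    and ten :: "'o \<Rightarrow> 'o \<Rightarrow> 'o"  (infixr \<open>\<otimes>\<close> 75)
    and tenA :: "'m \<Rightarrow> 'm \<Rightarrow> 'm"  (infixr \<open>\<boxtimes>\<close> 75)
    and unit ass lun run sym star starA +
  fixes phi :: "'o \<Rightarrow> 'o \<Rightarrow> 'o \<Rightarrow> 'm \<Rightarrow> 'm"
  assumes phi_bij: "A \<in> Obj C \<Longrightarrow> B \<in> Obj C \<Longrightarrow> D \<in> Obj C
      \<Longrightarrow> bij_betw (phi A B D) (Hom C (A \<otimes> B) (star D)) (Hom C A (star (B \<otimes> D)))"
    and phi_natural: "f \<in> Hom C A' A \<Longrightarrow> g \<in> Hom C B' B \<Longrightarrow> h \<in> Hom C D' D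
      \<Longrightarrow> k \<in> Hom C (A \<otimes> B) (star D)
      \<Longrightarrow> phi A' B' D' ((f \<boxtimes> g) ;; k ;; starA h) = f ;; phi A B D k ;; starA (g \<boxtimes> h)"


section \<open>Polarities and compatible relations\<close>

record ('a, 'b) polarity =
  neg :: "'a set"
  pos :: "'b set"
  inc :: "('a \<times> 'b) set"

definition polarity :: "('a, 'b) polarity \<Rightarrow> bool" where
  "polarity A \<longleftrightarrow> inc A \<subseteq> neg A \<times> pos A"

text \<open>A relation does not determine the sets it is a relation between, so the ambient set in which
  the value of the map lies is an argument.\<close>

definition down :: "'a set \<Rightarrow> ('a \<times> 'b) set \<Rightarrow> 'b set \<Rightarrow> 'a set" where
  "down A R Y = {a \<in> A. \<forall>y \<in> Y. (a, y) \<in> R}"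

definition up :: "'b set \<Rightarrow> ('a \<times> 'b) set \<Rightarrow> 'a set \<Rightarrow> 'b set" where
  "up B R X = {y \<in> B. \<forall>a \<in> X. (a, y) \<in> R}"

definition cl_neg :: "('a, 'b) polarity \<Rightarrow> 'a set \<Rightarrow> 'a set" where
  "cl_neg A X = down (neg A) (inc A) (up (pos A) (inc A) X)"

definition cl_pos :: "('a, 'b) polarity \<Rightarrow> 'b set \<Rightarrow> 'b set" where
  "cl_pos A Y = up (pos A) (inc A) (down (neg A) (inc A) Y)"

definition compatible :: "('a, 'b) polarity \<Rightarrow> ('c, 'd) polarity \<Rightarrow> ('a \<times> 'd) set \<Rightarrow> bool" where
  "compatible A B R \<longleftrightarrow> R \<subseteq> neg A \<times> pos B \<and>
     (\<forall>Y. Y \<subseteq> pos B \<longrightarrow> cl_neg A (down (neg A) R Y) = down (neg A) R Y) \<and>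
     (\<forall>Y. Y \<subseteq> pos B \<longrightarrow> down (neg A) R (cl_pos B Y) = down (neg A) R Y)"

record ('a, 'b, 'c, 'd) pol_arrow =
  source :: "('a, 'b) polarity"
  target :: "('c, 'd) polarity"
  rel :: "('a \<times> 'd) set"

definition pol_arrow :: "('a, 'b, 'c, 'd) pol_arrow \<Rightarrow> bool" where
  "pol_arrow f \<longleftrightarrow> polarity (source f) \<and> polarity (target f) \<and>
     compatible (source f) (target f) (rel f)"

definition pol_comp ::
  "('a, 'b, 'c, 'd) pol_arrow \<Rightarrow> ('c, 'd, 'e, 'f) pol_arrow \<Rightarrow> ('a, 'b, 'e, 'f) pol_arrow" where
  "pol_comp f g = \<lparr>source = source f, target = target g,
     rel = {(a, c). a \<in> neg (source f) \<and> c \<in> pos (target g) \<and>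
       a \<in> down (neg (source f)) (rel f)
             (up (pos (target f)) (inc (target f)) (down (neg (source g)) (rel g) {c}))}\<rparr>"

definition pol_id :: "('a, 'b) polarity \<Rightarrow> ('a, 'b, 'a, 'b) pol_arrow" where
  "pol_id A = \<lparr>source = A, target = A, rel = inc A\<rparr>"

definition dual :: "('a, 'b) polarity \<Rightarrow> ('b, 'a) polarity" where
  "dual A = \<lparr>neg = pos A, pos = neg A, inc = (inc A)\<inverse>\<rparr>"

definition dual_arrow :: "('a, 'b, 'c, 'd) pol_arrow \<Rightarrow> ('d, 'c, 'b, 'a) pol_arrow" where
  "dual_arrow f = \<lparr>source = dual (target f), target = dual (source f), rel = (rel f)\<inverse>\<rparr>"

definition stable :: "('a, 'b) polarity \<Rightarrow> ('c, 'd) polarity \<Rightarrow> ('a \<times> 'c) set \<Rightarrow> bool" where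
  "stable A B T \<longleftrightarrow> compatible A (dual B) T"

definition stable_hull ::
  "('a, 'b) polarity \<Rightarrow> ('c, 'd) polarity \<Rightarrow> ('a \<times> 'c) set \<Rightarrow> ('a \<times> 'c) set" where
  "stable_hull A B T = \<Inter>{T'. stable A B T' \<and> T \<subseteq> T'}"

definition tensor ::
  "('a, 'b) polarity \<Rightarrow> ('c, 'd) polarity \<Rightarrow> ('a \<times> 'c, ('a \<times> 'c) set) polarity" where
  "tensor A B = \<lparr>neg = neg A \<times> neg B, pos = Pow (neg A \<times> neg B),
     inc = {(x, T). x \<in> neg A \<times> neg B \<and> T \<in> Pow (neg A \<times> neg B) \<and> x \<in> stable_hull A B T}\<rparr>"

definition tensor_arrow ::
  "('a1, 'a2, 'b1, 'b2) pol_arrow \<Rightarrow> ('c1, 'c2, 'd1, 'd2) pol_arrow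
   \<Rightarrow> ('a1 \<times> 'c1, ('a1 \<times> 'c1) set, 'b1 \<times> 'd1, ('b1 \<times> 'd1) set) pol_arrow" where
  "tensor_arrow q s =
     \<lparr>source = tensor (source q) (source s), target = tensor (target q) (target s),
      rel = {((a, c), R). a \<in> neg (source q) \<and> c \<in> neg (source s) \<and>
        R \<in> Pow (neg (target q) \<times> neg (target s)) \<and>
        (a, c) \<in> rel (pol_comp
          (pol_comp q \<lparr>source = target q, target = dual (target s),
                       rel = stable_hull (target q) (target s) R\<rparr>)
          (dual_arrow s))}\<rparr>"


section \<open>The category of polarities in a universe of sets\<close>

text \<open>The tensor product of polarities on types \<open>'a\<close> and \<open>'b\<close> lives on the types \<open>'a \<times> 'b\<close> and
  \<open>('a \<times> 'b) set\<close>, and by Cantor's theorem these cannot all be embedded in one type. To have all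
  objects of the category in one type, we take polarities whose underlying sets are sets of a model
  \<open>'v\<close> of set theory, where \<open>elts x\<close> is the set of members of \<open>x\<close>. The axioms are those of
  Zermelo (with separation for arbitrary HOL predicates) without infinity, choice or foundation;
  they hold for instance in every standard model of ZF, and when \<open>'v\<close> is a limit stage of
  the cumulative hierarchy.\<close>

locale set_universe =
  fixes elts :: "'v \<Rightarrow> 'v set"
  assumes extensionality: "elts x = elts y \<Longrightarrow> x = y"
    and separation: "X \<subseteq> elts x \<Longrightarrow> X \<in> range elts"
    and pairing: "{x, y} \<in> range elts"
    and union: "(\<Union>y \<in> elts x. elts y) \<in> range elts"
    and powerset: "{y. elts y \<subseteq> elts x} \<in> range elts"

text \<open>The axioms are consistent: the hereditarily finite sets, in Ackermann's coding, satisfy them.\<close>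

lemma set_universe_hereditarily_finite: "set_universe set_decode"
proof -
  have fin: "X \<in> range set_decode" if "finite X" for X :: "nat set"
    using that by (metis rangeI set_encode_inverse)
  have inj: "x = y" if "set_decode x = set_decode y" for x y
    using that by (metis set_decode_inverse)
  have "finite {y. set_decode y \<subseteq> set_decode x}" for x
  proof (rule finite_imageD)
    show "finite (set_decode ` {y. set_decode y \<subseteq> set_decode x})"
      by (rule finite_subset[of _ "Pow (set_decode x)"]) auto
    show "inj_on set_decode {y. set_decode y \<subseteq> set_decode x}"
      by (auto intro: inj_onI inj)
  qed
  then show ?thesis
    by unfold_locales (auto intro!: fin inj intro: finite_subset[OF _ finite_set_decode])
qed

text \<open>\<open>set_of elts X\<close> is the element of the universe with set of members \<open>X\<close>, provided there is one.\<close>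

definition set_of :: "('v \<Rightarrow> 'v set) \<Rightarrow> 'v set \<Rightarrow> 'v" where
  "set_of elts X = inv elts X"

text \<open>Kuratowski pairs.\<close>

definition opair :: "('v \<Rightarrow> 'v set) \<Rightarrow> 'v \<times> 'v \<Rightarrow> 'v" where
  "opair elts = (\<lambda>(a, b). set_of elts {set_of elts {a}, set_of elts {a, b}})"

definition graph_of :: "('v \<Rightarrow> 'v set) \<Rightarrow> ('v \<times> 'v) set \<Rightarrow> 'v" where
  "graph_of elts T = set_of elts (opair elts ` T)"

text \<open>Ordered pairs and sets of ordered pairs are replaced by the elements of the universe that
  represent them.\<close>

definition internalize ::
  "('v \<Rightarrow> 'v set) \<Rightarrow> ('v \<times> 'v, ('v \<times> 'v) set) polarity \<Rightarrow> ('v, 'v) polarity" where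
  "internalize elts A = \<lparr>neg = opair elts ` neg A, pos = graph_of elts ` pos A,
     inc = map_prod (opair elts) (graph_of elts) ` inc A\<rparr>"

definition internalize_arrow ::
  "('v \<Rightarrow> 'v set)
   \<Rightarrow> ('v \<times> 'v, ('v \<times> 'v) set, 'v \<times> 'v, ('v \<times> 'v) set) pol_arrow \<Rightarrow> ('v, 'v, 'v, 'v) pol_arrow" where
  "internalize_arrow elts f =
     \<lparr>source = internalize elts (source f), target = internalize elts (target f),
      rel = map_prod (opair elts) (graph_of elts) ` rel f\<rparr>"

definition pol_obj :: "('v \<Rightarrow> 'v set) \<Rightarrow> ('v, 'v) polarity set" where
  "pol_obj elts = {A. polarity A \<and> neg A \<in> range elts \<and> pos A \<in> range elts}"

definition Pol :: "('v \<Rightarrow> 'v set) \<Rightarrow> (('v, 'v) polarity, ('v, 'v, 'v, 'v) pol_arrow) cat" where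
  "Pol elts = \<lparr>Obj = pol_obj elts,
     Arr = {f. pol_arrow f \<and> source f \<in> pol_obj elts \<and> target f \<in> pol_obj elts},
     src = source, tgt = target, idn = pol_id, comp = pol_comp\<rparr>"

definition Pol_tensor ::
  "('v \<Rightarrow> 'v set) \<Rightarrow> ('v, 'v) polarity \<Rightarrow> ('v, 'v) polarity \<Rightarrow> ('v, 'v) polarity" where
  "Pol_tensor elts A B = internalize elts (tensor A B)"

definition Pol_tensor_arrow ::
  "('v \<Rightarrow> 'v set) \<Rightarrow> ('v, 'v, 'v, 'v) pol_arrow \<Rightarrow> ('v, 'v, 'v, 'v) pol_arrow
   \<Rightarrow> ('v, 'v, 'v, 'v) pol_arrow" where
  "Pol_tensor_arrow elts q s = internalize_arrow elts (tensor_arrow q s)"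

text \<open>The point of the unit is taken to be the empty set of the universe.\<close>

definition Pol_unit :: "('v \<Rightarrow> 'v set) \<Rightarrow> ('v, 'v) polarity" where
  "Pol_unit elts = \<lparr>neg = {set_of elts {}}, pos = {set_of elts {}}, inc = {}\<rparr>"

end

theory Submission
  imports Defs
begin

text \<open>
Only the left-hand set \<open>neg A\<close> of a polarity and its closed subsets (the fixed points of
\<open>cl_neg A\<close>) matter for the proof, because everything in the category can be described by them. Call a
multivalued map \<open>G\<close> from \<open>neg A\<close> to \<open>neg B\<close> continuous if the set of all \<open>a\<close> with \<open>G a \<subseteq> X\<close> is closed
whenever \<open>X\<close> is closed. Such a \<open>G\<close> induces a compatible relation, which relates \<open>a\<close> to \<open>y\<close> if all points
of \<open>G a\<close> are incident with \<open>y\<close>. Three facts turn this into a calculus.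

\<^item> Every compatible relation \<open>R\<close> is induced by a continuous multimap: map \<open>a\<close> to the closed
  set of all points incident with each \<open>y\<close> that \<open>a\<close> is \<open>R\<close>-related to (\<open>pol_arrow_eq_induced\<close>).

\<^item> Composition in \<open>Pol\<close> of induced arrows is composition of multimaps as binary relations
  (\<open>pol_comp_induced_induced\<close>), and the identity is induced by the map \<open>a \<mapsto> {a}\<close>.

\<^item> The closed sets of \<open>A \<otimes> B\<close> are the stable sets, that is, the sets of pairs all of whose sections are
  closed in \<open>A\<close> or in \<open>B\<close> (\<open>closed_set_Pol_tensor\<close>). Consequently the tensor product of induced
  arrows is induced by the pointwise product of the multimaps (\<open>Pol_tensor_arrow_induced\<close>).

So \<open>Pol\<close> is a quotient of the category of polarities and continuous multimaps, in which arrows are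
composed and tensored as binary relations between sets are. The structural isomorphisms are induced by the evident single-valued
bijections between cartesian products, whose continuity in both directions is read off from the
description by sections, and each coherence or naturality law is an equation between multimaps that
holds on the nose, pair by pair.

For the star-autonomous structure, apply the description by sections to a compatible relation from
\<open>A \<otimes> B\<close> to \<open>dual D\<close>. It is a ternary relation between the points of \<open>A\<close>, \<open>B\<close> and \<open>D\<close>
all of whose one-variable sections are closed; a compatible relation from \<open>A\<close> to
\<open>dual (B \<otimes> D)\<close> is the same ternary relation with other brackets. Moving the brackets is therefore a
bijection of hom-sets. It is natural, because composing such a relation with arrows
induced by \<open>F\<close>, \<open>G\<close> and \<open>H\<close> on its three sides yields the relation of all \<open>(a, b, d)\<close>
with \<open>F a \<times> G b \<times> H d\<close> contained in it, for either bracketing.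
\<close>

section \<open>Closed sets and compatibility\<close>

definition closed_set :: "('a, 'b) polarity \<Rightarrow> 'a set \<Rightarrow> bool" where
  "closed_set A X \<longleftrightarrow> X \<subseteq> neg A \<and> cl_neg A X = X"

lemma closed_set_iff:
  "closed_set A X \<longleftrightarrow> X \<subseteq> neg A \<and>
     (\<forall>x \<in> neg A. (\<forall>y \<in> pos A. (\<forall>a \<in> X. (a, y) \<in> inc A) \<longrightarrow> (x, y) \<in> inc A) \<longrightarrow> x \<in> X)"
  unfolding closed_set_def cl_neg_def down_def up_def by blast

lemma closed_set_subset: "closed_set A X \<Longrightarrow> X \<subseteq> neg A"
  by (simp add: closed_set_def)

lemma cl_neg_superset: "X \<subseteq> neg A \<Longrightarrow> X \<subseteq> cl_neg A X"
  by (auto simp: cl_neg_def down_def up_def)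

lemma cl_neg_least: "closed_set A Z \<Longrightarrow> X \<subseteq> Z \<Longrightarrow> cl_neg A X \<subseteq> Z"
  unfolding closed_set_iff cl_neg_def down_def up_def by blast

lemma closed_set_Inter:
  assumes "\<And>i. i \<in> I \<Longrightarrow> closed_set A {a \<in> neg A. P i a}"
  shows "closed_set A {a \<in> neg A. \<forall>i \<in> I. P i a}"
  using assms unfolding closed_set_iff by simp

text \<open>This serves to pass from the tensor product on a product type to its copy inside the universe.\<close>

lemma closed_set_image:
  assumes "inj p" and sel: "neg B = p ` neg A" "pos B = g ` pos A"
    and inc: "\<And>x y. y \<in> pos A \<Longrightarrow> x \<in> neg A \<Longrightarrow> (p x, g y) \<in> inc B \<longleftrightarrow> (x, y) \<in> inc A"
    and T: "T \<subseteq> neg A"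
  shows "closed_set B (p ` T) \<longleftrightarrow> closed_set A T"
proof -
  have "(\<forall>a \<in> T. (p a, g y) \<in> inc B) \<longleftrightarrow> (\<forall>a \<in> T. (a, y) \<in> inc A)" if "y \<in> pos A" for y
    using inc[OF that] T by blast
  then show ?thesis
    unfolding closed_set_iff sel using T
    by (simp add: inc image_mono inj_image_mem_iff[OF \<open>inj p\<close>] cong: ball_cong)
qed

lemma closed_set_polar:
  "Y \<subseteq> pos A \<Longrightarrow> closed_set A {a \<in> neg A. \<forall>y \<in> Y. (a, y) \<in> inc A}"
  unfolding closed_set_iff by blast

lemma closed_set_column: "y \<in> pos A \<Longrightarrow> closed_set A {a \<in> neg A. (a, y) \<in> inc A}"
  using closed_set_polar[of "{y}" A] by simp

lemma dual_dual [simp]: "dual (dual A) = A"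
  by (simp add: dual_def)

lemma dual_sel [simp]:
  "neg (dual A) = pos A" "pos (dual A) = neg A" "inc (dual A) = (inc A)\<inverse>"
  by (simp_all add: dual_def)

lemma polarity_dual: "polarity A \<Longrightarrow> polarity (dual A)"
  by (auto simp: polarity_def)

lemma cl_pos_eq: "cl_pos A = cl_neg (dual A)"
  by (auto simp: fun_eq_iff cl_pos_def cl_neg_def up_def down_def)

text \<open>Both closure conditions in the definition of compatibility can be tested on single points: columns
are the values at singletons and the other values are intersections of columns, while closedness
of the row of \<open>a\<close> is the second condition at the row itself. In this form the definition is visibly
symmetric under duality.\<close>

lemma compatible_iff:
  "compatible A B R \<longleftrightarrow> R \<subseteq> neg A \<times> pos B \<and>
     (\<forall>y \<in> pos B. closed_set A {a \<in> neg A. (a, y) \<in> R}) \<and>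
     (\<forall>a \<in> neg A. closed_set (dual B) {y \<in> pos B. (a, y) \<in> R})"
  (is "_ \<longleftrightarrow> ?sub \<and> ?col \<and> ?row")
proof -
  have "(\<forall>Y. Y \<subseteq> pos B \<longrightarrow> cl_neg A (down (neg A) R Y) = down (neg A) R Y) \<longleftrightarrow> ?col"
  proof
    assume L: "\<forall>Y. Y \<subseteq> pos B \<longrightarrow> cl_neg A (down (neg A) R Y) = down (neg A) R Y"
    show ?col
    proof
      fix y assume "y \<in> pos B"
      then have "cl_neg A (down (neg A) R {y}) = down (neg A) R {y}" using L by simp
      then show "closed_set A {a \<in> neg A. (a, y) \<in> R}" by (simp add: closed_set_def down_def)
    qed
  next
    assume R: ?col
    show "\<forall>Y. Y \<subseteq> pos B \<longrightarrow> cl_neg A (down (neg A) R Y) = down (neg A) R Y"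
    proof (intro allI impI)
      fix Y assume "Y \<subseteq> pos B"
      then have "closed_set A {a \<in> neg A. \<forall>y \<in> Y. (a, y) \<in> R}"
        by (intro closed_set_Inter) (use R in blast)
      then show "cl_neg A (down (neg A) R Y) = down (neg A) R Y"
        by (simp add: closed_set_def down_def)
    qed
  qed
  moreover have "(\<forall>Y. Y \<subseteq> pos B \<longrightarrow> down (neg A) R (cl_pos B Y) = down (neg A) R Y) \<longleftrightarrow> ?row"
  proof
    assume L: "\<forall>Y. Y \<subseteq> pos B \<longrightarrow> down (neg A) R (cl_pos B Y) = down (neg A) R Y"
    show ?row
    proof
      fix a assume a: "a \<in> neg A"
      let ?Y = "{y \<in> pos B. (a, y) \<in> R}"
      \<comment> \<open>The point \<open>a\<close> lies in the value at its own row, hence also in the value at the closure of that row.\<close>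
      have "a \<in> down (neg A) R (cl_pos B ?Y)"
        using L a by (auto simp: down_def)
      then have "\<forall>y \<in> cl_pos B ?Y. (a, y) \<in> R" by (simp add: down_def)
      moreover have "cl_pos B ?Y \<subseteq> pos B" by (simp add: cl_pos_def up_def)
      ultimately have "cl_pos B ?Y \<subseteq> ?Y" by blast
      moreover have "?Y \<subseteq> cl_pos B ?Y" unfolding cl_pos_eq by (rule cl_neg_superset) auto
      ultimately show "closed_set (dual B) ?Y" unfolding closed_set_def cl_pos_eq by auto
    qed
  next
    assume R: ?row
    show "\<forall>Y. Y \<subseteq> pos B \<longrightarrow> down (neg A) R (cl_pos B Y) = down (neg A) R Y"
    proof (intro allI impI set_eqI)
      fix Y a assume Y: "Y \<subseteq> pos B"
      have mem: "a \<in> down (neg A) R Z \<longleftrightarrow> a \<in> neg A \<and> Z \<subseteq> {y. (a, y) \<in> R}" for Z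
        by (auto simp: down_def)
      have "cl_pos B Y \<subseteq> {y. (a, y) \<in> R}" if "a \<in> neg A" "Y \<subseteq> {y. (a, y) \<in> R}"
      proof -
        have "closed_set (dual B) {y \<in> pos B. (a, y) \<in> R}" using R that(1) by blast
        then have "cl_pos B Y \<subseteq> {y \<in> pos B. (a, y) \<in> R}"
          unfolding cl_pos_eq by (rule cl_neg_least) (use that(2) Y in blast)
        then show ?thesis by blast
      qed
      moreover have "Y \<subseteq> cl_pos B Y" unfolding cl_pos_eq by (rule cl_neg_superset) (simp add: Y)
      ultimately show "a \<in> down (neg A) R (cl_pos B Y) \<longleftrightarrow> a \<in> down (neg A) R Y"
        unfolding mem by blast
    qed
  qed
  ultimately show ?thesis unfolding compatible_def by (simp only:)
qed

lemma stable_iff: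
  "stable A B T \<longleftrightarrow> T \<subseteq> neg A \<times> neg B \<and>
     (\<forall>b \<in> neg B. closed_set A {a \<in> neg A. (a, b) \<in> T}) \<and>
     (\<forall>a \<in> neg A. closed_set B {b \<in> neg B. (a, b) \<in> T})"
  by (simp add: stable_def compatible_iff)

lemma compatible_dual: "compatible A B R \<Longrightarrow> compatible (dual B) (dual A) (R\<inverse>)"
  by (auto simp: compatible_iff)

lemma pol_arrow_dual: "pol_arrow f \<Longrightarrow> pol_arrow (dual_arrow f)"
  by (simp add: pol_arrow_def dual_arrow_def polarity_dual compatible_dual)


section \<open>Arrows from continuous multimaps\<close>

text \<open>The values are arbitrary sets. Replacing them by their closures does not change the induced arrow, but
only without closures are composites and products of multimaps again plain unions and products.\<close>

definition continuous_multimap ::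
  "('a, 'b) polarity \<Rightarrow> ('c, 'd) polarity \<Rightarrow> ('a \<Rightarrow> 'c set) \<Rightarrow> bool" where
  "continuous_multimap A B G \<longleftrightarrow> (\<forall>a \<in> neg A. G a \<subseteq> neg B) \<and>
     (\<forall>X. closed_set B X \<longrightarrow> closed_set A {a \<in> neg A. G a \<subseteq> X})"

definition induced ::
  "('a, 'b) polarity \<Rightarrow> ('c, 'd) polarity \<Rightarrow> ('a \<Rightarrow> 'c set) \<Rightarrow> ('a, 'b, 'c, 'd) pol_arrow" where
  "induced A B G = \<lparr>source = A, target = B,
     rel = {(a, y). a \<in> neg A \<and> y \<in> pos B \<and> (\<forall>b \<in> G a. (b, y) \<in> inc B)}\<rparr>"

lemma induced_sel [simp]:
  "source (induced A B G) = A" "target (induced A B G) = B"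
  by (simp_all add: induced_def)

lemma induced_cong: "(\<And>a. a \<in> neg A \<Longrightarrow> G a = H a) \<Longrightarrow> induced A B G = induced A B H"
  by (auto simp: induced_def)

lemma pol_arrow_induced:
  assumes "polarity A" "polarity B" and G: "continuous_multimap A B G"
  shows "pol_arrow (induced A B G)"
proof -
  have "closed_set A {a \<in> neg A. \<forall>b \<in> G a. (b, y) \<in> inc B}" if y: "y \<in> pos B" for y
  proof -
    have "closed_set A {a \<in> neg A. G a \<subseteq> {b \<in> neg B. (b, y) \<in> inc B}}"
      using G closed_set_column[OF y] by (simp add: continuous_multimap_def)
    also have "{a \<in> neg A. G a \<subseteq> {b \<in> neg B. (b, y) \<in> inc B}} =
        {a \<in> neg A. \<forall>b \<in> G a. (b, y) \<in> inc B}"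
      using G by (auto simp: continuous_multimap_def)
    finally show ?thesis .
  qed
  moreover have "closed_set (dual B) {y \<in> pos B. \<forall>b \<in> G a. (b, y) \<in> inc B}" if "a \<in> neg A" for a
    using closed_set_polar[of "G a" "dual B"] G that by (simp add: continuous_multimap_def)
  ultimately show ?thesis
    using assms(1,2) by (auto simp: pol_arrow_def compatible_iff induced_def cong: conj_cong)
qed

text \<open>The witness is the largest multimap inducing the arrow. It is continuous because a closed set \<open>X\<close> is the
intersection of the basic closed sets of those \<open>y\<close> that are incident with all of \<open>X\<close>, so that the preimage of
\<open>X\<close> is an intersection of columns of the relation.\<close>

lemma pol_arrow_eq_induced:
  assumes "pol_arrow f"
  obtains G where "continuous_multimap (source f) (target f) G" "f = induced (source f) (target f) G"
proof -
  define A B R where "A = source f" and "B = target f" and "R = rel f"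
  have R: "R \<subseteq> neg A \<times> pos B"
    and col: "y \<in> pos B \<Longrightarrow> closed_set A {a \<in> neg A. (a, y) \<in> R}"
    and row: "a \<in> neg A \<Longrightarrow> closed_set (dual B) {y \<in> pos B. (a, y) \<in> R}" for a y
    using assms by (auto simp: pol_arrow_def compatible_iff A_def B_def R_def)
  define G where "G a = {b \<in> neg B. \<forall>y \<in> pos B. (a, y) \<in> R \<longrightarrow> (b, y) \<in> inc B}" for a
  \<comment> \<open>The points incident with all of \<open>G a\<close> form the closure of the row of \<open>a\<close>, and that row is closed.\<close>
  have rel_iff: "(a, y) \<in> R \<longleftrightarrow> (\<forall>b \<in> G a. (b, y) \<in> inc B)" if "a \<in> neg A" "y \<in> pos B" for a y
    using row[OF that(1)] that unfolding closed_set_iff G_def by simp blast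
  have "f = induced A B G"
    using R rel_iff by (auto simp: induced_def A_def B_def R_def intro!: pol_arrow.equality)
  moreover have "continuous_multimap A B G"
    unfolding continuous_multimap_def
  proof (intro conjI allI impI ballI)
    fix X assume X: "closed_set B X"
    let ?Y = "{y \<in> pos B. \<forall>b \<in> X. (b, y) \<in> inc B}"
    have "closed_set A {a \<in> neg A. \<forall>y \<in> ?Y. (a, y) \<in> R}"
      by (intro closed_set_Inter) (use col in blast)
    also have "{a \<in> neg A. \<forall>y \<in> ?Y. (a, y) \<in> R} = {a \<in> neg A. G a \<subseteq> X}"
    proof (intro Collect_cong conj_cong refl iffI)
      fix a assume a: "a \<in> neg A" and "\<forall>y \<in> ?Y. (a, y) \<in> R"
      then show "G a \<subseteq> X"
        using X unfolding closed_set_iff G_def by blast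
    next
      fix a assume a: "a \<in> neg A" and "G a \<subseteq> X"
      then show "\<forall>y \<in> ?Y. (a, y) \<in> R" using rel_iff by blast
    qed
    finally show "closed_set A {a \<in> neg A. G a \<subseteq> X}" .
  qed (auto simp: G_def)
  ultimately show ?thesis using that unfolding A_def B_def by blast
qed

text \<open>The definition says that \<open>a\<close> and \<open>y\<close> are related by the composite if each \<open>z\<close> incident with all of
the column of \<open>y\<close> under \<open>g\<close> is incident with all of \<open>G a\<close>. As that column is closed, this says
that \<open>G a\<close> is contained in it.\<close>

lemma pol_comp_induced:
  assumes G: "\<And>a. a \<in> neg A \<Longrightarrow> G a \<subseteq> neg B" and g: "pol_arrow g" "source g = B"
  shows "pol_comp (induced A B G) g = \<lparr>source = A, target = target g,
    rel = {(a, y). a \<in> neg A \<and> y \<in> pos (target g) \<and> (\<forall>b \<in> G a. (b, y) \<in> rel g)}\<rparr>"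
proof -
  have "a \<in> down (neg A) (rel (induced A B G)) (up (pos B) (inc B) (down (neg B) (rel g) {y}))
      \<longleftrightarrow> (\<forall>b \<in> G a. (b, y) \<in> rel g)" if a: "a \<in> neg A" and y: "y \<in> pos (target g)" for a y
  proof -
    let ?X = "{b \<in> neg B. (b, y) \<in> rel g}"
    have X: "closed_set B ?X" using g y by (auto simp: pol_arrow_def compatible_iff)
    have "a \<in> down (neg A) (rel (induced A B G)) (up (pos B) (inc B) (down (neg B) (rel g) {y}))
        \<longleftrightarrow> (\<forall>z \<in> pos B. (\<forall>b \<in> ?X. (b, z) \<in> inc B) \<longrightarrow> (\<forall>b \<in> G a. (b, z) \<in> inc B))"
      using a by (auto simp: down_def up_def induced_def)
    also have "\<dots> \<longleftrightarrow> G a \<subseteq> ?X"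
      using X G[OF a] unfolding closed_set_iff by blast
    finally show ?thesis using G[OF a] by blast
  qed
  then show ?thesis using g by (auto simp: pol_comp_def)
qed

lemma continuous_multimap_subset: "continuous_multimap A B G \<Longrightarrow> \<forall>a \<in> neg A. G a \<subseteq> neg B"
  by (simp add: continuous_multimap_def)

lemma continuous_multimap_comp:
  assumes "continuous_multimap A B G" "continuous_multimap B C H"
  shows "continuous_multimap A C (\<lambda>a. \<Union>b \<in> G a. H b)"
  unfolding continuous_multimap_def
proof (intro conjI allI impI ballI)
  fix X assume "closed_set C X"
  then have "closed_set A {a \<in> neg A. G a \<subseteq> {b \<in> neg B. H b \<subseteq> X}}"
    using assms by (simp add: continuous_multimap_def)
  also have "{a \<in> neg A. G a \<subseteq> {b \<in> neg B. H b \<subseteq> X}} = {a \<in> neg A. (\<Union>b \<in> G a. H b) \<subseteq> X}"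
    using assms by (fastforce simp: continuous_multimap_def)
  finally show "closed_set A {a \<in> neg A. (\<Union>b \<in> G a. H b) \<subseteq> X}" .
qed (use assms in \<open>fastforce simp: continuous_multimap_def\<close>)

lemma pol_comp_induced_induced:
  assumes "polarity B" "polarity C"
    and G: "\<forall>a \<in> neg A. G a \<subseteq> neg B" and H: "continuous_multimap B C H"
  shows "pol_comp (induced A B G) (induced B C H) = induced A C (\<lambda>a. \<Union>b \<in> G a. H b)"
proof -
  have G': "a \<in> neg A \<Longrightarrow> G a \<subseteq> neg B" for a using G by blast
  have "pol_arrow (induced B C H)" by (simp add: pol_arrow_induced assms)
  then have "pol_comp (induced A B G) (induced B C H) = \<lparr>source = A, target = C,
      rel = {(a, y). a \<in> neg A \<and> y \<in> pos C \<and> (\<forall>b \<in> G a. (b, y) \<in> rel (induced B C H))}\<rparr>"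
    by (subst pol_comp_induced) (use G' in auto)
  also have "\<dots> = induced A C (\<lambda>a. \<Union>b \<in> G a. H b)"
    using G' by (auto simp: induced_def)
  finally show ?thesis .
qed

lemma pol_arrow_comp:
  assumes "pol_arrow f" "pol_arrow g" "target f = source g"
  shows "pol_arrow (pol_comp f g)"
proof -
  obtain G where G: "continuous_multimap (source f) (source g) G"
      "f = induced (source f) (source g) G"
    using pol_arrow_eq_induced[OF assms(1)] assms(3) by auto
  obtain H where H: "continuous_multimap (source g) (target g) H"
      "g = induced (source g) (target g) H"
    using pol_arrow_eq_induced[OF assms(2)] .
  have pol: "polarity (source f)" "polarity (source g)" "polarity (target g)"
    using assms by (simp_all add: pol_arrow_def)
  have "pol_comp f g = induced (source f) (target g) (\<lambda>a. \<Union>b \<in> G a. H b)"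
    using pol_comp_induced_induced[OF pol(2,3) continuous_multimap_subset[OF G(1)] H(1)] G(2) H(2)
    by simp
  then show ?thesis
    using pol_arrow_induced[OF pol(1,3) continuous_multimap_comp[OF G(1) H(1)]] by simp
qed

lemma pol_id_eq_induced: "polarity A \<Longrightarrow> pol_id A = induced A A (\<lambda>a. {a})"
  by (auto simp: pol_id_def induced_def polarity_def)

lemma continuous_multimap_singleton:
  "continuous_multimap A B (\<lambda>a. {f a}) \<longleftrightarrow> (\<forall>a \<in> neg A. f a \<in> neg B) \<and>
     (\<forall>X. closed_set B X \<longrightarrow> closed_set A {a \<in> neg A. f a \<in> X})"
  by (simp add: continuous_multimap_def)

lemma continuous_multimap_id: "continuous_multimap A A (\<lambda>a. {a})"
proof -
  have "{a \<in> neg A. a \<in> X} = X" if "closed_set A X" for X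
    using closed_set_subset[OF that] by blast
  then show ?thesis by (simp add: continuous_multimap_singleton)
qed

lemma dual_arrow_sel [simp]:
  "source (dual_arrow f) = dual (target f)" "target (dual_arrow f) = dual (source f)"
  "rel (dual_arrow f) = (rel f)\<inverse>"
  by (simp_all add: dual_arrow_def)

lemma dual_arrow_dual_arrow [simp]: "dual_arrow (dual_arrow f) = f"
  by (simp add: dual_arrow_def)

text \<open>If \<open>f\<close> is induced by \<open>G\<close> and the dual of \<open>g\<close> by \<open>H\<close>, then both sides relate \<open>a\<close> and \<open>y\<close> precisely when all
points of \<open>G a\<close> are incident with all points of \<open>H y\<close>.\<close>

lemma dual_arrow_comp:
  assumes "pol_arrow f" "pol_arrow g" "target f = source g"
  shows "dual_arrow (pol_comp f g) = pol_comp (dual_arrow g) (dual_arrow f)"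
proof -
  obtain G where G: "continuous_multimap (source f) (target f) G"
      "f = induced (source f) (target f) G"
    using pol_arrow_eq_induced[OF assms(1)] .
  have Gsub: "a \<in> neg (source f) \<Longrightarrow> G a \<subseteq> neg (source g)" for a
    using G assms(3) by (simp add: continuous_multimap_def)
  define A B where "A = source f" and "B = source g"
  have f: "f = induced A B G" using G assms(3) by (simp add: A_def B_def)
  obtain H where H: "continuous_multimap (dual (target g)) (dual B) H"
      "dual_arrow g = induced (dual (target g)) (dual B) H"
    using pol_arrow_eq_induced[OF pol_arrow_dual[OF assms(2)]] by (auto simp: B_def)
  have HB: "y \<in> pos (target g) \<Longrightarrow> H y \<subseteq> pos B" for y
    using H by (simp add: continuous_multimap_def)
  have g: "(b, y) \<in> rel g \<longleftrightarrow> b \<in> neg B \<and> y \<in> pos (target g) \<and> (\<forall>z \<in> H y. (b, z) \<in> inc B)" for b y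
  proof -
    have "(b, y) \<in> rel g \<longleftrightarrow> (y, b) \<in> rel (dual_arrow g)" by simp
    also have "\<dots> \<longleftrightarrow> b \<in> neg B \<and> y \<in> pos (target g) \<and> (\<forall>z \<in> H y. (b, z) \<in> inc B)"
      unfolding H(2) by (auto simp: induced_def)
    finally show ?thesis .
  qed
  have 1: "pol_comp f g = \<lparr>source = A, target = target g,
    rel = {(a, y). a \<in> neg A \<and> y \<in> pos (target g) \<and> (\<forall>b \<in> G a. (b, y) \<in> rel g)}\<rparr>"
    using Gsub unfolding f by (intro pol_comp_induced) (auto simp: A_def B_def assms)
  have 2: "pol_comp (dual_arrow g) (dual_arrow f) = \<lparr>source = dual (target g), target = dual A,
    rel = {(y, a). y \<in> pos (target g) \<and> a \<in> neg A \<and> (\<forall>z \<in> H y. (z, a) \<in> rel (dual_arrow f))}\<rparr>"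
    unfolding H(2) using HB pol_arrow_dual[OF assms(1)]
    by (subst pol_comp_induced) (auto simp: f)
  have "(\<forall>b \<in> G a. (b, y) \<in> rel g) \<longleftrightarrow> (\<forall>z \<in> H y. (a, z) \<in> rel f)"
    if "a \<in> neg A" "y \<in> pos (target g)" for a y
  proof -
    have "(a, z) \<in> rel f \<longleftrightarrow> (\<forall>b \<in> G a. (b, z) \<in> inc B)" if "z \<in> H y" for z
      using \<open>a \<in> neg A\<close> \<open>y \<in> pos (target g)\<close> HB that by (subst f) (auto simp: induced_def)
    moreover have "(b, y) \<in> rel g \<longleftrightarrow> (\<forall>z \<in> H y. (b, z) \<in> inc B)" if "b \<in> G a" for b
      using g Gsub that \<open>a \<in> neg A\<close> \<open>y \<in> pos (target g)\<close> by (auto simp: A_def B_def)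
    ultimately show ?thesis by blast
  qed
  then show ?thesis unfolding 1 2 by (auto simp: dual_arrow_def)
qed

text \<open>The mirror image of \<open>pol_comp_induced\<close>, obtained by duality.\<close>

lemma pol_comp_dual_induced:
  assumes H: "continuous_multimap D' D H" and "polarity D'" "polarity D"
    and k: "pol_arrow k" "target k = dual D"
  shows "pol_comp k (dual_arrow (induced D' D H)) = \<lparr>source = source k, target = dual D',
    rel = {(a, d'). a \<in> neg (source k) \<and> d' \<in> neg D' \<and> (\<forall>d \<in> H d'. (a, d) \<in> rel k)}\<rparr>"
proof -
  let ?h = "induced D' D H"
  have h: "pol_arrow ?h" using assms by (simp add: pol_arrow_induced)
  have "pol_comp k (dual_arrow ?h) = dual_arrow (pol_comp ?h (dual_arrow k))"
    using k h by (subst dual_arrow_comp) (auto simp: pol_arrow_dual)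
  also have "\<dots> = \<lparr>source = source k, target = dual D',
    rel = {(a, d'). a \<in> neg (source k) \<and> d' \<in> neg D' \<and> (\<forall>d \<in> H d'. (a, d) \<in> rel k)}\<rparr>"
    using H k by (subst pol_comp_induced)
      (auto simp: continuous_multimap_def pol_arrow_dual, auto simp: dual_arrow_def)
  finally show ?thesis .
qed


section \<open>Closed sets of the tensor product\<close>

lemma stable_Inter:
  assumes stable: "\<And>T. T \<in> S \<Longrightarrow> stable A B T" and "S \<noteq> {}"
  shows "stable A B (\<Inter>S)"
proof -
  have "closed_set A {a \<in> neg A. \<forall>T \<in> S. (a, b) \<in> T}" if "b \<in> neg B" for b
  proof (rule closed_set_Inter)
    show "closed_set A {a \<in> neg A. (a, b) \<in> T}" if "T \<in> S" for T
      using stable[OF that] \<open>b \<in> neg B\<close> by (simp add: stable_iff)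
  qed
  moreover have "closed_set B {b \<in> neg B. \<forall>T \<in> S. (a, b) \<in> T}" if "a \<in> neg A" for a
  proof (rule closed_set_Inter)
    show "closed_set B {b \<in> neg B. (a, b) \<in> T}" if "T \<in> S" for T
      using stable[OF that] \<open>a \<in> neg A\<close> by (simp add: stable_iff)
  qed
  moreover have "\<Inter>S \<subseteq> neg A \<times> neg B"
  proof -
    obtain T where "T \<in> S" using \<open>S \<noteq> {}\<close> by blast
    then show ?thesis using stable[OF \<open>T \<in> S\<close>] by (auto simp only: stable_iff)
  qed
  ultimately show ?thesis by (simp add: stable_iff)
qed

lemma stable_Times: "stable A B (neg A \<times> neg B)"
  using closed_set_polar[of "{}" A] closed_set_polar[of "{}" B] by (simp add: stable_iff)

lemma stable_hull_stable: "T \<subseteq> neg A \<times> neg B \<Longrightarrow> stable A B (stable_hull A B T)"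
  unfolding stable_hull_def by (rule stable_Inter) (use stable_Times in auto)

lemma stable_hull_superset: "T \<subseteq> stable_hull A B T"
  by (auto simp: stable_hull_def)

lemma stable_hull_least: "stable A B T' \<Longrightarrow> T \<subseteq> T' \<Longrightarrow> stable_hull A B T \<subseteq> T'"
  by (auto simp: stable_hull_def)

lemma stable_hull_id: "stable A B T \<Longrightarrow> stable_hull A B T = T"
  using stable_hull_superset stable_hull_least by blast


text \<open>The incidence relation of the tensor product makes the stable hulls the basic closed sets, and intersections of
stable sets are stable.\<close>

lemma closed_set_tensor: "closed_set (tensor A B) T \<longleftrightarrow> stable A B T"
proof -
  let ?N = "neg A \<times> neg B"
  have *: "closed_set (tensor A B) T \<longleftrightarrow> T \<subseteq> ?N \<and>
      (\<forall>x \<in> ?N. (\<forall>R \<in> Pow ?N. T \<subseteq> stable_hull A B R \<longrightarrow> x \<in> stable_hull A B R) \<longrightarrow> x \<in> T)"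
  proof (cases "T \<subseteq> ?N")
    case True
    have sel: "neg (tensor A B) = ?N" "pos (tensor A B) = Pow ?N" by (simp_all add: tensor_def)
    have inc: "(x, R) \<in> inc (tensor A B) \<longleftrightarrow> x \<in> stable_hull A B R"
      if "x \<in> ?N" "R \<in> Pow ?N" for x R
      using that by (simp add: tensor_def)
    have inc': "(\<forall>a \<in> T. (a, R) \<in> inc (tensor A B)) \<longleftrightarrow> T \<subseteq> stable_hull A B R"
      if "R \<in> Pow ?N" for R
      using True inc that by blast
    show ?thesis
      unfolding closed_set_iff sel by (simp only: inc inc' cong: ball_cong)
  qed (simp add: closed_set_iff tensor_def)
  show ?thesis
  proof
    assume T: "closed_set (tensor A B) T"
    then have sub: "T \<subseteq> ?N" using * by blast
    have "stable_hull A B T \<subseteq> T"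
    proof
      fix x assume x: "x \<in> stable_hull A B T"
      have "x \<in> stable_hull A B R" if "R \<in> Pow ?N" "T \<subseteq> stable_hull A B R" for R
        using stable_hull_least[OF stable_hull_stable that(2)] that(1) x by blast
      moreover have "x \<in> ?N"
        using stable_hull_least[OF stable_Times sub] x by blast
      ultimately show "x \<in> T" using T * by blast
    qed
    then have "stable_hull A B T = T" using stable_hull_superset by blast
    then show "stable A B T" using stable_hull_stable[OF sub] by simp
  next
    assume T: "stable A B T"
    \<comment> \<open>A stable set is itself a point on the right-hand side, and it is incident with its elements only.\<close>
    then have "T \<in> Pow ?N" by (simp add: stable_iff)
    then show "closed_set (tensor A B) T"
      unfolding * using stable_hull_id[OF T] by blast
  qed
qed

text \<open>In the composite that defines the tensor product of arrows, the stable hull is composed on the left with an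
induced arrow and on the right with the dual of one; each of the two composites replaces a point by
all points of its image.\<close>

lemma tensor_arrow_induced:
  assumes G: "continuous_multimap A A' G" and H: "continuous_multimap B B' H"
    and pol: "polarity A" "polarity A'" "polarity B" "polarity B'"
  shows "tensor_arrow (induced A A' G) (induced B B' H) =
    \<lparr>source = tensor A B, target = tensor A' B',
     rel = {((a, b), T). a \<in> neg A \<and> b \<in> neg B \<and> T \<in> Pow (neg A' \<times> neg B') \<and>
       G a \<times> H b \<subseteq> stable_hull A' B' T}\<rparr>"
proof -
  have "(a, b) \<in> rel (pol_comp (pol_comp (induced A A' G)
      \<lparr>source = A', target = dual B', rel = stable_hull A' B' T\<rparr>) (dual_arrow (induced B B' H)))
    \<longleftrightarrow> G a \<times> H b \<subseteq> stable_hull A' B' T"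
    if "a \<in> neg A" "b \<in> neg B" "T \<in> Pow (neg A' \<times> neg B')" for a b T
  proof -
    let ?U = "\<lparr>source = A', target = dual B', rel = stable_hull A' B' T\<rparr>"
    have U: "pol_arrow ?U"
      using stable_hull_stable[of T A' B'] that pol
      by (simp add: pol_arrow_def stable_def polarity_dual)
    have G': "\<And>a. a \<in> neg A \<Longrightarrow> G a \<subseteq> neg A'" and H': "\<And>b. b \<in> neg B \<Longrightarrow> H b \<subseteq> neg B'"
      using G H by (simp_all add: continuous_multimap_def)
    let ?k = "pol_comp (induced A A' G) ?U"
    have k: "?k = \<lparr>source = A, target = dual B',
       rel = {(a, b). a \<in> neg A \<and> b \<in> neg B' \<and> (\<forall>a' \<in> G a. (a', b) \<in> stable_hull A' B' T)}\<rparr>"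
      using pol_comp_induced[OF G' U] by simp
    have "pol_arrow ?k"
      by (rule pol_arrow_comp) (simp_all add: U pol_arrow_induced pol G)
    then have "pol_comp ?k (dual_arrow (induced B B' H)) = \<lparr>source = source ?k, target = dual B,
       rel = {(a, d'). a \<in> neg (source ?k) \<and> d' \<in> neg B \<and> (\<forall>d \<in> H d'. (a, d) \<in> rel ?k)}\<rparr>"
      by (intro pol_comp_dual_induced H pol) (simp_all add: k)
    then show ?thesis
      using that H' by (auto simp: k)
  qed
  then show ?thesis by (auto simp: tensor_arrow_def)
qed


section \<open>Pairs and tensor products inside the universe\<close>

context set_universe
begin

abbreviation pair :: "'v \<Rightarrow> 'v \<Rightarrow> 'v" where
  "pair a b \<equiv> opair elts (a, b)"

definition unpair :: "'v \<Rightarrow> 'v \<times> 'v" where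
  "unpair = inv (opair elts)"

lemma elts_set_of: "X \<in> range elts \<Longrightarrow> elts (set_of elts X) = X"
  unfolding set_of_def by (rule f_inv_into_f)

lemma elts_upair: "elts (set_of elts {x, y}) = {x, y}"
  by (rule elts_set_of) (rule pairing)

lemma elts_singleton: "elts (set_of elts {x}) = {x}"
  using elts_upair[of x x] by simp

lemma inj_opair: "inj (opair elts)"
proof (rule injI, clarify)
  fix a b c d assume "opair elts (a, b) = opair elts (c, d)"
  then have "elts (opair elts (a, b)) = elts (opair elts (c, d))" by simp
  then have "elts ` {set_of elts {a}, set_of elts {a, b}} = elts ` {set_of elts {c}, set_of elts {c, d}}"
    by (simp add: opair_def elts_upair)
  then have "{{a}, {a, b}} = {{c}, {c, d}}" by (simp add: elts_upair elts_singleton)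
  then show "a = c \<and> b = d" by (auto simp: doubleton_eq_iff)
qed

lemma opair_eq_iff [simp]: "opair elts x = opair elts y \<longleftrightarrow> x = y"
  using inj_opair by (auto dest: injD)

lemma opair_in_image_iff [simp]: "opair elts x \<in> opair elts ` S \<longleftrightarrow> x \<in> S"
  by (rule inj_image_mem_iff[OF inj_opair])

lemma unpair_opair [simp]: "unpair (opair elts x) = x"
  unfolding unpair_def using inj_opair by simp

lemma range_elts_subset: "X \<in> range elts \<Longrightarrow> Y \<subseteq> X \<Longrightarrow> Y \<in> range elts"
  using separation by blast

lemma range_elts_Un:
  assumes "X \<in> range elts" "Y \<in> range elts"
  shows "X \<union> Y \<in> range elts"
proof -
  obtain x y where "X = elts x" "Y = elts y" using assms by blast
  then show ?thesis using union[of "set_of elts {x, y}"] by (simp add: elts_upair)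
qed

lemma range_elts_powerset: "X \<in> range elts \<Longrightarrow> {y. elts y \<subseteq> X} \<in> range elts"
  using powerset by blast

text \<open>A Kuratowski pair over \<open>X\<close> and \<open>Y\<close> is a set of subsets of \<open>X \<union> Y\<close>.\<close>

lemma range_elts_Times:
  assumes "X \<in> range elts" "Y \<in> range elts"
  shows "opair elts ` (X \<times> Y) \<in> range elts"
proof (rule range_elts_subset)
  show "{z. elts z \<subseteq> {y. elts y \<subseteq> X \<union> Y}} \<in> range elts"
    by (intro range_elts_powerset range_elts_Un assms)
  show "opair elts ` (X \<times> Y) \<subseteq> {z. elts z \<subseteq> {y. elts y \<subseteq> X \<union> Y}}"
    by (auto simp: opair_def elts_upair elts_singleton)
qed

lemma elts_graph_of: "opair elts ` T \<in> range elts \<Longrightarrow> elts (graph_of elts T) = opair elts ` T"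
  by (simp add: graph_of_def elts_set_of)

text \<open>Injectivity is restricted to subsets of a set of pairs that lies in the universe, since \<open>set_of\<close> is unspecified on
collections that are too large to be sets of the universe.\<close>

lemma inj_on_graph_of:
  assumes "opair elts ` N \<in> range elts"
  shows "inj_on (graph_of elts) (Pow N)"
proof (rule inj_onI)
  fix S T assume "S \<in> Pow N" "T \<in> Pow N" and eq: "graph_of elts S = graph_of elts T"
  then have "opair elts ` S \<in> range elts" "opair elts ` T \<in> range elts"
    by (auto intro!: range_elts_subset[OF assms])
  then have "opair elts ` S = opair elts ` T" using eq elts_graph_of by metis
  then show "S = T" by (simp add: inj_image_eq_iff[OF inj_opair])
qed

lemma graph_of_image_Pow:
  assumes "opair elts ` N \<in> range elts"
  shows "graph_of elts ` Pow N = {y. elts y \<subseteq> opair elts ` N}"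
proof (intro equalityI subsetI)
  fix y assume "y \<in> {y. elts y \<subseteq> opair elts ` N}"
  then obtain T where T: "T \<subseteq> N" "elts y = opair elts ` T" by (auto simp: subset_image_iff)
  then have "elts (graph_of elts T) = elts y" by (metis elts_graph_of rangeI)
  then show "y \<in> graph_of elts ` Pow N" using T extensionality by blast
next
  fix y assume "y \<in> graph_of elts ` Pow N"
  then obtain T where T: "T \<subseteq> N" "y = graph_of elts T" by blast
  then have "opair elts ` T \<in> range elts" by (auto intro!: range_elts_subset[OF assms])
  then show "y \<in> {y. elts y \<subseteq> opair elts ` N}" using T by (auto simp: elts_graph_of)
qed

abbreviation tensor_pol :: "('v, 'v) polarity \<Rightarrow> ('v, 'v) polarity \<Rightarrow> ('v, 'v) polarity"
    (infixr \<open>\<odot>\<close> 75) where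
  "A \<odot> B \<equiv> Pol_tensor elts A B"

lemma neg_Pol_tensor: "neg (A \<odot> B) = opair elts ` (neg A \<times> neg B)"
  by (simp add: Pol_tensor_def internalize_def tensor_def)

lemma pos_Pol_tensor: "pos (A \<odot> B) = graph_of elts ` Pow (neg A \<times> neg B)"
  by (simp add: Pol_tensor_def internalize_def tensor_def)

lemma pair_in_Pol_tensor [simp]: "pair a b \<in> neg (A \<odot> B) \<longleftrightarrow> a \<in> neg A \<and> b \<in> neg B"
  by (auto simp: neg_Pol_tensor)

lemma range_elts_tensor:
  "A \<in> pol_obj elts \<Longrightarrow> B \<in> pol_obj elts \<Longrightarrow> opair elts ` (neg A \<times> neg B) \<in> range elts"
  by (simp add: pol_obj_def range_elts_Times)

lemma polarity_pol_obj: "A \<in> pol_obj elts \<Longrightarrow> polarity A"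
  by (simp add: pol_obj_def)

lemma Pol_tensor_obj:
  assumes "A \<in> pol_obj elts" "B \<in> pol_obj elts"
  shows "A \<odot> B \<in> pol_obj elts"
proof -
  have "inc (A \<odot> B) \<subseteq> neg (A \<odot> B) \<times> pos (A \<odot> B)"
    by (auto simp: Pol_tensor_def internalize_def tensor_def)
  then show ?thesis
    using range_elts_tensor[OF assms] range_elts_powerset
    by (simp add: pol_obj_def polarity_def neg_Pol_tensor pos_Pol_tensor graph_of_image_Pow)
qed

lemma inc_Pol_tensor:
  assumes "A \<in> pol_obj elts" "B \<in> pol_obj elts" "T \<subseteq> neg A \<times> neg B" "z \<in> neg A \<times> neg B"
  shows "(opair elts z, graph_of elts T) \<in> inc (A \<odot> B) \<longleftrightarrow> z \<in> stable_hull A B T"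
proof
  assume "(opair elts z, graph_of elts T) \<in> inc (A \<odot> B)"
  then obtain R where R: "(z, R) \<in> inc (tensor A B)" "graph_of elts T = graph_of elts R"
    by (auto simp: Pol_tensor_def internalize_def)
  then have "R \<in> Pow (neg A \<times> neg B)" by (auto simp: tensor_def)
  then have "T = R"
    using inj_onD[OF inj_on_graph_of[OF range_elts_tensor[OF assms(1,2)]] R(2)] assms(3) by simp
  then show "z \<in> stable_hull A B T" using R(1) by (simp add: tensor_def)
next
  assume "z \<in> stable_hull A B T"
  then have "(z, T) \<in> inc (tensor A B)" using assms(3,4) by (simp add: tensor_def)
  then have "map_prod (opair elts) (graph_of elts) (z, T) \<in> inc (A \<odot> B)"
    unfolding Pol_tensor_def internalize_def polarity.simps by (rule imageI)
  then show "(opair elts z, graph_of elts T) \<in> inc (A \<odot> B)" by simp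
qed

lemma closed_set_Pol_tensor_stable:
  assumes "A \<in> pol_obj elts" "B \<in> pol_obj elts" "T \<subseteq> neg A \<times> neg B"
  shows "closed_set (A \<odot> B) (opair elts ` T) \<longleftrightarrow> stable A B T"
proof -
  have "(opair elts z, graph_of elts R) \<in> inc (A \<odot> B) \<longleftrightarrow> (z, R) \<in> inc (tensor A B)"
    if "R \<in> Pow (neg A \<times> neg B)" "z \<in> neg A \<times> neg B" for R z
    using inc_Pol_tensor[OF assms(1,2)] that by (simp add: tensor_def)
  then have "closed_set (A \<odot> B) (opair elts ` T) \<longleftrightarrow> closed_set (tensor A B) T"
    by (intro closed_set_image[OF inj_opair])
      (simp_all add: tensor_def neg_Pol_tensor pos_Pol_tensor assms(3))
  then show ?thesis by (simp add: closed_set_tensor)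
qed

text \<open>This criterion is the only property of the tensor product of objects on which continuity proofs rely:
a set is closed as soon as it is closed in each variable separately.\<close>

lemma closed_set_Pol_tensor:
  assumes "A \<in> pol_obj elts" "B \<in> pol_obj elts"
  shows "closed_set (A \<odot> B) Z \<longleftrightarrow> Z \<subseteq> neg (A \<odot> B) \<and>
    (\<forall>b \<in> neg B. closed_set A {a \<in> neg A. pair a b \<in> Z}) \<and>
    (\<forall>a \<in> neg A. closed_set B {b \<in> neg B. pair a b \<in> Z})"
proof (cases "Z \<subseteq> neg (A \<odot> B)")
  case True
  then obtain T where T: "T \<subseteq> neg A \<times> neg B" "Z = opair elts ` T"
    by (auto simp: neg_Pol_tensor subset_image_iff)
  then show ?thesis
    using True closed_set_Pol_tensor_stable[OF assms T(1)]
    by (simp add: stable_iff inj_image_mem_iff[OF inj_opair])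
qed (simp add: closed_set_iff)

definition multimap_prod :: "('v \<Rightarrow> 'v set) \<Rightarrow> ('v \<Rightarrow> 'v set) \<Rightarrow> 'v \<Rightarrow> 'v set" where
  "multimap_prod G H = (\<lambda>x. case unpair x of (a, b) \<Rightarrow> opair elts ` (G a \<times> H b))"

lemma multimap_prod_pair [simp]: "multimap_prod G H (pair a b) = opair elts ` (G a \<times> H b)"
  by (simp add: multimap_prod_def)

lemma multimap_prod_UN:
  "(\<Union>y \<in> multimap_prod F F' x. multimap_prod G G' y) =
    multimap_prod (\<lambda>a. \<Union>b \<in> F a. G b) (\<lambda>a. \<Union>b \<in> F' a. G' b) x"
  by (cases "unpair x") (simp add: multimap_prod_def, blast)

text \<open>Each section of the preimage of \<open>Z\<close> is the preimage under one of the two multimaps of an intersection of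
sections of \<open>Z\<close>.\<close>

lemma continuous_multimap_prod:
  assumes G: "continuous_multimap A A' G" and H: "continuous_multimap B B' H"
    and obj: "A \<in> pol_obj elts" "A' \<in> pol_obj elts" "B \<in> pol_obj elts" "B' \<in> pol_obj elts"
  shows "continuous_multimap (A \<odot> B) (A' \<odot> B') (multimap_prod G H)"
proof -
  have G': "\<And>a. a \<in> neg A \<Longrightarrow> G a \<subseteq> neg A'" and H': "\<And>b. b \<in> neg B \<Longrightarrow> H b \<subseteq> neg B'"
    using G H by (simp_all add: continuous_multimap_def)
  have "closed_set (A \<odot> B) {x \<in> neg (A \<odot> B). multimap_prod G H x \<subseteq> Z}"
    if Z: "closed_set (A' \<odot> B') Z" for Z
  proof -
    have "closed_set A {a \<in> neg A. opair elts ` (G a \<times> H b) \<subseteq> Z}" if b: "b \<in> neg B" for b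
    proof -
      have "closed_set A' {a' \<in> neg A'. \<forall>b' \<in> H b. pair a' b' \<in> Z}"
        by (rule closed_set_Inter) (use Z H'[OF b] in \<open>auto simp: closed_set_Pol_tensor obj\<close>)
      then have "closed_set A {a \<in> neg A. G a \<subseteq> {a' \<in> neg A'. \<forall>b' \<in> H b. pair a' b' \<in> Z}}"
        using G by (simp add: continuous_multimap_def)
      also have "{a \<in> neg A. G a \<subseteq> {a' \<in> neg A'. \<forall>b' \<in> H b. pair a' b' \<in> Z}} =
          {a \<in> neg A. opair elts ` (G a \<times> H b) \<subseteq> Z}"
        using G' by blast
      finally show ?thesis .
    qed
    moreover have "closed_set B {b \<in> neg B. opair elts ` (G a \<times> H b) \<subseteq> Z}" if a: "a \<in> neg A" for a
    proof -
      have "closed_set B' {b' \<in> neg B'. \<forall>a' \<in> G a. pair a' b' \<in> Z}"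
        by (rule closed_set_Inter) (use Z G'[OF a] in \<open>auto simp: closed_set_Pol_tensor obj\<close>)
      then have "closed_set B {b \<in> neg B. H b \<subseteq> {b' \<in> neg B'. \<forall>a' \<in> G a. pair a' b' \<in> Z}}"
        using H by (simp add: continuous_multimap_def)
      also have "{b \<in> neg B. H b \<subseteq> {b' \<in> neg B'. \<forall>a' \<in> G a. pair a' b' \<in> Z}} =
          {b \<in> neg B. opair elts ` (G a \<times> H b) \<subseteq> Z}"
        using H' by blast
      finally show ?thesis .
    qed
    ultimately show ?thesis by (simp add: closed_set_Pol_tensor obj)
  qed
  moreover have "multimap_prod G H x \<subseteq> neg (A' \<odot> B')" if "x \<in> neg (A \<odot> B)" for x
    using that G' H' by (fastforce simp: neg_Pol_tensor)
  ultimately show ?thesis by (simp add: continuous_multimap_def)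
qed

text \<open>The stable hull of \<open>T\<close> contains \<open>G a \<times> H b\<close> if and only if every pair in \<open>G a \<times> H b\<close> is incident with
\<open>T\<close> in the tensor product, so the relation in the definition has the form of an induced arrow.\<close>

lemma Pol_tensor_arrow_induced:
  assumes G: "continuous_multimap A A' G" and H: "continuous_multimap B B' H"
    and obj: "A \<in> pol_obj elts" "A' \<in> pol_obj elts" "B \<in> pol_obj elts" "B' \<in> pol_obj elts"
  shows "Pol_tensor_arrow elts (induced A A' G) (induced B B' H) =
    induced (A \<odot> B) (A' \<odot> B') (multimap_prod G H)"
proof -
  let ?S = "{((a, b), T). a \<in> neg A \<and> b \<in> neg B \<and> T \<in> Pow (neg A' \<times> neg B') \<and>
       G a \<times> H b \<subseteq> stable_hull A' B' T}"
  have S: "Pol_tensor_arrow elts (induced A A' G) (induced B B' H) =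
      \<lparr>source = A \<odot> B, target = A' \<odot> B', rel = map_prod (opair elts) (graph_of elts) ` ?S\<rparr>"
    by (simp add: Pol_tensor_arrow_def internalize_arrow_def Pol_tensor_def
        tensor_arrow_induced[OF G H] obj polarity_pol_obj)
  have sub: "G a \<times> H b \<subseteq> neg A' \<times> neg B'" if "a \<in> neg A" "b \<in> neg B" for a b
    using G H that by (auto simp: continuous_multimap_def)
  have key: "(\<forall>z \<in> multimap_prod G H (pair a b). (z, graph_of elts T) \<in> inc (A' \<odot> B')) \<longleftrightarrow>
      G a \<times> H b \<subseteq> stable_hull A' B' T"
    if "a \<in> neg A" "b \<in> neg B" "T \<subseteq> neg A' \<times> neg B'" for a b T
  proof -
    have "(\<forall>z \<in> multimap_prod G H (pair a b). (z, graph_of elts T) \<in> inc (A' \<odot> B')) \<longleftrightarrow>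
        (\<forall>z \<in> G a \<times> H b. (opair elts z, graph_of elts T) \<in> inc (A' \<odot> B'))" by auto
    also have "\<dots> \<longleftrightarrow> (\<forall>z \<in> G a \<times> H b. z \<in> stable_hull A' B' T)"
      using sub[OF that(1,2)] by (intro ball_cong refl inc_Pol_tensor obj that(3)) blast
    finally show ?thesis by blast
  qed
  have "map_prod (opair elts) (graph_of elts) ` ?S = {(x, y). x \<in> neg (A \<odot> B) \<and>
      y \<in> pos (A' \<odot> B') \<and> (\<forall>z \<in> multimap_prod G H x. (z, y) \<in> inc (A' \<odot> B'))}" (is "_ = ?R")
  proof (intro equalityI subsetI)
    fix w assume "w \<in> map_prod (opair elts) (graph_of elts) ` ?S"
    then obtain a b T where w: "w = (pair a b, graph_of elts T)" and "((a, b), T) \<in> ?S" by auto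
    then show "w \<in> ?R" using key[of a b T] by (auto simp: pos_Pol_tensor simp del: multimap_prod_pair)
  next
    fix w assume w: "w \<in> ?R"
    then obtain a b T where ab: "a \<in> neg A" "b \<in> neg B" "T \<subseteq> neg A' \<times> neg B'"
      and w': "w = (pair a b, graph_of elts T)"
      by (auto simp: pos_Pol_tensor neg_Pol_tensor)
    then have "((a, b), T) \<in> ?S" using w key[of a b T] by auto
    then show "w \<in> map_prod (opair elts) (graph_of elts) ` ?S" using w' by force
  qed
  then show ?thesis unfolding S by (simp add: induced_def)
qed


section \<open>The category of polarities\<close>

lemma Pol_sel [simp]:
  "Obj (Pol elts) = pol_obj elts" "comp (Pol elts) = pol_comp" "idn (Pol elts) = pol_id"
  by (simp_all add: Pol_def)

lemma Hom_Pol_iff: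
  "f \<in> Hom (Pol elts) A B \<longleftrightarrow> A \<in> pol_obj elts \<and> B \<in> pol_obj elts \<and> pol_arrow f \<and>
     source f = A \<and> target f = B"
  by (auto simp: Hom_def Pol_def)

lemma induced_Hom:
  "A \<in> pol_obj elts \<Longrightarrow> B \<in> pol_obj elts \<Longrightarrow> continuous_multimap A B G \<Longrightarrow>
    induced A B G \<in> Hom (Pol elts) A B"
  by (simp add: Hom_Pol_iff pol_arrow_induced polarity_pol_obj)

lemma Hom_PolE:
  assumes "f \<in> Hom (Pol elts) A B"
  obtains G where "A \<in> pol_obj elts" "B \<in> pol_obj elts" "continuous_multimap A B G"
    "\<forall>a \<in> neg A. G a \<subseteq> neg B" "f = induced A B G"
proof -
  have f: "A \<in> pol_obj elts" "B \<in> pol_obj elts" "pol_arrow f" "source f = A" "target f = B"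
    using assms by (simp_all add: Hom_Pol_iff)
  obtain G where G: "continuous_multimap A B G" "f = induced A B G"
    using pol_arrow_eq_induced[OF f(3)] f(4,5) by blast
  show ?thesis by (rule that[OF f(1,2) G(1) continuous_multimap_subset[OF G(1)] G(2)])
qed

text \<open>Rewriting with these equations turns an equation between arrows into an equation between multimaps.\<close>

lemmas multimap_calculus = pol_comp_induced_induced Pol_tensor_arrow_induced pol_id_eq_induced
  polarity_pol_obj Pol_tensor_obj continuous_multimap_id continuous_multimap_prod

lemma category_Pol: "category (Pol elts)"
proof
  fix f A B g D h E
  assume "f \<in> Hom (Pol elts) A B" "g \<in> Hom (Pol elts) B D" "h \<in> Hom (Pol elts) D E"
  then obtain F G H where obj: "A \<in> pol_obj elts" "B \<in> pol_obj elts" "D \<in> pol_obj elts" "E \<in> pol_obj elts"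
    and F: "\<forall>a \<in> neg A. F a \<subseteq> neg B" "f = induced A B F"
    and G: "continuous_multimap B D G" "\<forall>a \<in> neg B. G a \<subseteq> neg D" "g = induced B D G"
    and H: "continuous_multimap D E H" "\<forall>a \<in> neg D. H a \<subseteq> neg E" "h = induced D E H"
    by (elim Hom_PolE) blast
  have FG: "\<forall>a \<in> neg A. (\<Union>b \<in> F a. G b) \<subseteq> neg D" using F G by blast
  note GH = continuous_multimap_comp[OF G(1) H(1)]
  show "comp (Pol elts) (comp (Pol elts) f g) h = comp (Pol elts) f (comp (Pol elts) g h)"
    using F(1) G(1,2) H(1) FG GH obj unfolding F(2) G(3) H(3) by (simp add: multimap_calculus)
next
  fix f A B assume "f \<in> Hom (Pol elts) A B"
  then obtain F where "A \<in> pol_obj elts" "B \<in> pol_obj elts" "continuous_multimap A B F"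
     "\<forall>a \<in> neg A. F a \<subseteq> neg B" "f = induced A B F" by (rule Hom_PolE)
  then show "comp (Pol elts) (idn (Pol elts) A) f = f" "comp (Pol elts) f (idn (Pol elts) B) = f"
    by (simp_all add: multimap_calculus)
next
  fix f g A B D assume fg: "f \<in> Hom (Pol elts) A B" "g \<in> Hom (Pol elts) B D"
  then show "comp (Pol elts) f g \<in> Hom (Pol elts) A D"
    by (auto simp: Hom_Pol_iff pol_arrow_comp) (simp_all add: pol_comp_def)
qed (auto simp: Pol_def Hom_def multimap_calculus pol_arrow_induced)

lemma dual_obj: "A \<in> pol_obj elts \<Longrightarrow> dual A \<in> pol_obj elts"
  by (simp add: pol_obj_def polarity_dual)

lemma contravariant_endofunctor_Pol: "contravariant_endofunctor (Pol elts) dual dual_arrow"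
proof (rule contravariant_endofunctor.intro[OF category_Pol], unfold_locales)
  show "A \<in> Obj (Pol elts) \<Longrightarrow> dual A \<in> Obj (Pol elts)" for A by (simp add: dual_obj)
  show "f \<in> Hom (Pol elts) A B \<Longrightarrow> dual_arrow f \<in> Hom (Pol elts) (dual B) (dual A)" for f A B
    by (auto simp: Hom_Pol_iff dual_obj pol_arrow_dual)
  show "dual_arrow (idn (Pol elts) A) = idn (Pol elts) (dual A)" for A
    by (simp add: pol_id_def dual_arrow_def)
  show "f \<in> Hom (Pol elts) A B \<Longrightarrow> g \<in> Hom (Pol elts) B D \<Longrightarrow>
    dual_arrow (comp (Pol elts) f g) = comp (Pol elts) (dual_arrow g) (dual_arrow f)" for f A B g D
    by (auto simp: Hom_Pol_iff dual_arrow_comp)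
qed


section \<open>The structural isomorphisms\<close>

definition reassoc :: "'v \<Rightarrow> 'v" where
  "reassoc x = (let (y, c) = unpair x; (a, b) = unpair y in pair a (pair b c))"

definition unreassoc :: "'v \<Rightarrow> 'v" where
  "unreassoc x = (let (a, y) = unpair x; (b, c) = unpair y in pair (pair a b) c)"

definition swap :: "'v \<Rightarrow> 'v" where
  "swap x = (let (a, b) = unpair x in pair b a)"

definition first :: "'v \<Rightarrow> 'v" where
  "first x = fst (unpair x)"

definition second :: "'v \<Rightarrow> 'v" where
  "second x = snd (unpair x)"

lemma structural_map_simps [simp]:
  "reassoc (pair (pair a b) c) = pair a (pair b c)"
  "unreassoc (pair a (pair b c)) = pair (pair a b) c"
  "swap (pair a b) = pair b a"
  "first (pair a b) = a"
  "second (pair a b) = b"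
  by (simp_all add: reassoc_def unreassoc_def swap_def first_def second_def)

lemma ball_Pol_tensor [simp]:
  "(\<forall>x \<in> neg (A \<odot> B). P x) \<longleftrightarrow> (\<forall>a \<in> neg A. \<forall>b \<in> neg B. P (pair a b))"
  by (auto simp: neg_Pol_tensor)

lemma pairs_subset_Pol_tensor [simp]:
  "X \<subseteq> neg A \<Longrightarrow> Y \<subseteq> neg B \<Longrightarrow> opair elts ` (X \<times> Y) \<subseteq> neg (A \<odot> B)"
  by auto

lemma Pol_unit_obj: "Pol_unit elts \<in> pol_obj elts"
  using pairing[of "set_of elts {}" "set_of elts {}"]
  by (simp add: pol_obj_def polarity_def Pol_unit_def)

lemma neg_Pol_unit [simp]: "neg (Pol_unit elts) = {set_of elts {}}"
  by (simp add: Pol_unit_def)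

text \<open>The unit carries the discrete closure: because its incidence relation is empty, even the empty set is closed.
So a set of pairs is closed in the tensor product with the unit as soon as its section is closed in the other factor.\<close>

lemma closed_set_Pol_unit: "closed_set (Pol_unit elts) X \<longleftrightarrow> X \<subseteq> {set_of elts {}}"
  by (auto simp: closed_set_iff Pol_unit_def)

lemma closed_set_Collect: "closed_set A X \<Longrightarrow> closed_set A {a \<in> neg A. a \<in> X}"
  using closed_set_Inter[of "{()}" A "\<lambda>_ a. a \<in> X"] by (simp add: closed_set_iff)

lemma continuous_reassoc:
  assumes "A \<in> pol_obj elts" "B \<in> pol_obj elts" "D \<in> pol_obj elts"
  shows "continuous_multimap ((A \<odot> B) \<odot> D) (A \<odot> (B \<odot> D)) (\<lambda>x. {reassoc x})"
  using assms
  by (simp add: continuous_multimap_singleton closed_set_Pol_tensor Pol_tensor_obj)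

lemma continuous_unreassoc:
  assumes "A \<in> pol_obj elts" "B \<in> pol_obj elts" "D \<in> pol_obj elts"
  shows "continuous_multimap (A \<odot> (B \<odot> D)) ((A \<odot> B) \<odot> D) (\<lambda>x. {unreassoc x})"
  using assms
  by (simp add: continuous_multimap_singleton closed_set_Pol_tensor Pol_tensor_obj)

lemma continuous_swap:
  assumes "A \<in> pol_obj elts" "B \<in> pol_obj elts"
  shows "continuous_multimap (A \<odot> B) (B \<odot> A) (\<lambda>x. {swap x})"
  using assms by (simp add: continuous_multimap_singleton closed_set_Pol_tensor)

lemma continuous_second:
  assumes "A \<in> pol_obj elts"
  shows "continuous_multimap (Pol_unit elts \<odot> A) A (\<lambda>x. {second x})"
  using assms by (auto simp: continuous_multimap_singleton closed_set_Pol_tensor Pol_unit_obj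
      closed_set_Pol_unit closed_set_Collect)

lemma continuous_first:
  assumes "A \<in> pol_obj elts"
  shows "continuous_multimap (A \<odot> Pol_unit elts) A (\<lambda>x. {first x})"
  using assms by (auto simp: continuous_multimap_singleton closed_set_Pol_tensor Pol_unit_obj
      closed_set_Pol_unit closed_set_Collect)

lemma continuous_unit_pair:
  assumes "A \<in> pol_obj elts"
  shows "continuous_multimap A (Pol_unit elts \<odot> A) (\<lambda>a. {pair (set_of elts {}) a})"
    and "continuous_multimap A (A \<odot> Pol_unit elts) (\<lambda>a. {pair a (set_of elts {})})"
  using assms by (simp_all add: continuous_multimap_singleton closed_set_Pol_tensor Pol_unit_obj)

lemma iso_in_singleton:
  assumes "A \<in> pol_obj elts" "B \<in> pol_obj elts"
    and f: "continuous_multimap A B (\<lambda>a. {f a})" and g: "continuous_multimap B A (\<lambda>b. {g b})"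
    and "\<forall>a \<in> neg A. g (f a) = a" "\<forall>b \<in> neg B. f (g b) = b"
  shows "iso_in (Pol elts) A B (induced A B (\<lambda>a. {f a}))"
  unfolding iso_in_def
proof (intro conjI bexI)
  show "induced A B (\<lambda>a. {f a}) \<in> Hom (Pol elts) A B" "induced B A (\<lambda>b. {g b}) \<in> Hom (Pol elts) B A"
    by (simp_all add: induced_Hom assms)
  show "comp (Pol elts) (induced A B (\<lambda>a. {f a})) (induced B A (\<lambda>b. {g b})) = idn (Pol elts) A"
    "comp (Pol elts) (induced B A (\<lambda>b. {g b})) (induced A B (\<lambda>a. {f a})) = idn (Pol elts) B"
    using f g assms continuous_multimap_subset[OF f] continuous_multimap_subset[OF g]
    by (auto simp: multimap_calculus intro!: induced_cong)
qed

definition associator :: "('v, 'v) polarity \<Rightarrow> ('v, 'v) polarity \<Rightarrow> ('v, 'v) polarity \<Rightarrow> _" where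
  "associator A B D = induced ((A \<odot> B) \<odot> D) (A \<odot> (B \<odot> D)) (\<lambda>x. {reassoc x})"

definition left_unitor :: "('v, 'v) polarity \<Rightarrow> _" where
  "left_unitor A = induced (Pol_unit elts \<odot> A) A (\<lambda>x. {second x})"

definition right_unitor :: "('v, 'v) polarity \<Rightarrow> _" where
  "right_unitor A = induced (A \<odot> Pol_unit elts) A (\<lambda>x. {first x})"

definition symmetry :: "('v, 'v) polarity \<Rightarrow> ('v, 'v) polarity \<Rightarrow> _" where
  "symmetry A B = induced (A \<odot> B) (B \<odot> A) (\<lambda>x. {swap x})"

lemmas structural_defs = associator_def left_unitor_def right_unitor_def symmetry_def

lemmas structural_continuity = continuous_reassoc continuous_unreassoc continuous_swap
  continuous_first continuous_second

lemma associator_iso: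
  assumes "A \<in> pol_obj elts" "B \<in> pol_obj elts" "D \<in> pol_obj elts"
  shows "iso_in (Pol elts) ((A \<odot> B) \<odot> D) (A \<odot> (B \<odot> D)) (associator A B D)"
  unfolding associator_def using assms
  by (auto intro!: iso_in_singleton Pol_tensor_obj continuous_reassoc continuous_unreassoc
      simp: neg_Pol_tensor)

lemma unitor_isos:
  assumes "A \<in> pol_obj elts"
  shows "iso_in (Pol elts) (Pol_unit elts \<odot> A) A (left_unitor A)"
    and "iso_in (Pol elts) (A \<odot> Pol_unit elts) A (right_unitor A)"
  unfolding left_unitor_def right_unitor_def using assms
  by (auto intro!: iso_in_singleton Pol_tensor_obj Pol_unit_obj continuous_first continuous_second
      continuous_unit_pair simp: neg_Pol_tensor)

abbreviation ten_arr (infixr \<open>\<boxdot>\<close> 75) where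
  "f \<boxdot> g \<equiv> Pol_tensor_arrow elts f g"

lemma tensor_arrow_comp:
  assumes "f \<in> Hom (Pol elts) A B" "g \<in> Hom (Pol elts) B D"
    "f' \<in> Hom (Pol elts) A' B'" "g' \<in> Hom (Pol elts) B' D'"
  shows "pol_comp f g \<boxdot> pol_comp f' g' = pol_comp (f \<boxdot> f') (g \<boxdot> g')"
proof -
  obtain F G F' G' where obj: "A \<in> pol_obj elts" "B \<in> pol_obj elts" "D \<in> pol_obj elts"
      "A' \<in> pol_obj elts" "B' \<in> pol_obj elts" "D' \<in> pol_obj elts"
    and F: "continuous_multimap A B F" "\<forall>a \<in> neg A. F a \<subseteq> neg B" "f = induced A B F"
    and G: "continuous_multimap B D G" "g = induced B D G"
    and F': "continuous_multimap A' B' F'" "\<forall>a \<in> neg A'. F' a \<subseteq> neg B'" "f' = induced A' B' F'"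
    and G': "continuous_multimap B' D' G'" "g' = induced B' D' G'"
    using assms by (elim Hom_PolE) blast
  note cont = continuous_multimap_comp[OF F(1) G(1)] continuous_multimap_comp[OF F'(1) G'(1)]
  show ?thesis
    using F(1,2) G(1) F'(1,2) G'(1) cont obj unfolding F(3) G(2) F'(3) G'(2)
    by (simp add: multimap_calculus multimap_prod_UN)
qed

text \<open>Both composites are induced by the multimap that takes \<open>((a, b), c)\<close> to \<open>F a \<times> (G b \<times> H c)\<close>.\<close>

lemma associator_natural:
  assumes "f \<in> Hom (Pol elts) A A'" "g \<in> Hom (Pol elts) B B'" "h \<in> Hom (Pol elts) D D'"
  shows "pol_comp ((f \<boxdot> g) \<boxdot> h) (associator A' B' D') = pol_comp (associator A B D) (f \<boxdot> g \<boxdot> h)"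
proof -
  obtain F G H where obj: "A \<in> pol_obj elts" "B \<in> pol_obj elts" "D \<in> pol_obj elts"
      "A' \<in> pol_obj elts" "B' \<in> pol_obj elts" "D' \<in> pol_obj elts"
    and F: "continuous_multimap A A' F" "\<forall>a \<in> neg A. F a \<subseteq> neg A'" "f = induced A A' F"
    and G: "continuous_multimap B B' G" "\<forall>a \<in> neg B. G a \<subseteq> neg B'" "g = induced B B' G"
    and H: "continuous_multimap D D' H" "\<forall>a \<in> neg D. H a \<subseteq> neg D'" "h = induced D D' H"
    using assms by (elim Hom_PolE) blast
  show ?thesis
    using F(1,2) G(1,2) H(1,2) obj unfolding F(3) G(3) H(3) structural_defs
    by (simp add: multimap_calculus structural_continuity)
      (rule induced_cong, auto simp: neg_Pol_tensor)
qed

lemma symmetry_natural: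
  assumes "f \<in> Hom (Pol elts) A A'" "g \<in> Hom (Pol elts) B B'"
  shows "pol_comp (f \<boxdot> g) (symmetry A' B') = pol_comp (symmetry A B) (g \<boxdot> f)"
proof -
  obtain F G where obj: "A \<in> pol_obj elts" "B \<in> pol_obj elts"
      "A' \<in> pol_obj elts" "B' \<in> pol_obj elts"
    and F: "continuous_multimap A A' F" "\<forall>a \<in> neg A. F a \<subseteq> neg A'" "f = induced A A' F"
    and G: "continuous_multimap B B' G" "\<forall>a \<in> neg B. G a \<subseteq> neg B'" "g = induced B B' G"
    using assms by (elim Hom_PolE) blast
  show ?thesis
    using F(1,2) G(1,2) obj unfolding F(3) G(3) structural_defs
    by (simp add: multimap_calculus structural_continuity)
      (rule induced_cong, auto simp: neg_Pol_tensor)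
qed

lemma unitors_natural:
  assumes "f \<in> Hom (Pol elts) A B"
  shows "pol_comp (pol_id (Pol_unit elts) \<boxdot> f) (left_unitor B) = pol_comp (left_unitor A) f"
    and "pol_comp (f \<boxdot> pol_id (Pol_unit elts)) (right_unitor B) = pol_comp (right_unitor A) f"
proof -
  obtain F where obj: "A \<in> pol_obj elts" "B \<in> pol_obj elts"
    and F: "continuous_multimap A B F" "\<forall>a \<in> neg A. F a \<subseteq> neg B" "f = induced A B F"
    using assms by (elim Hom_PolE) blast
  show "pol_comp (pol_id (Pol_unit elts) \<boxdot> f) (left_unitor B) = pol_comp (left_unitor A) f"
    using F(1,2) obj unfolding F(3) structural_defs
    by (simp add: multimap_calculus structural_continuity Pol_unit_obj)
      (rule induced_cong, auto simp: neg_Pol_tensor)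
  show "pol_comp (f \<boxdot> pol_id (Pol_unit elts)) (right_unitor B) = pol_comp (right_unitor A) f"
    using F(1,2) obj unfolding F(3) structural_defs
    by (simp add: multimap_calculus structural_continuity Pol_unit_obj)
      (rule induced_cong, auto simp: neg_Pol_tensor)
qed

lemma pentagon_Pol:
  assumes "A \<in> pol_obj elts" "B \<in> pol_obj elts" "D \<in> pol_obj elts" "E \<in> pol_obj elts"
  shows "pol_comp (associator (A \<odot> B) D E) (associator A B (D \<odot> E)) =
    pol_comp (pol_comp (associator A B D \<boxdot> pol_id E) (associator A (B \<odot> D) E))
      (pol_id A \<boxdot> associator B D E)"
  using assms unfolding structural_defs
  by (simp add: multimap_calculus structural_continuity) (rule induced_cong, auto simp: neg_Pol_tensor)

lemma triangle_Pol:
  assumes "A \<in> pol_obj elts" "B \<in> pol_obj elts"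
  shows "pol_comp (associator A (Pol_unit elts) B) (pol_id A \<boxdot> left_unitor B) =
    right_unitor A \<boxdot> pol_id B"
  using assms unfolding structural_defs
  by (simp add: multimap_calculus structural_continuity Pol_unit_obj)
    (rule induced_cong, auto simp: neg_Pol_tensor)

lemma hexagon_Pol:
  assumes "A \<in> pol_obj elts" "B \<in> pol_obj elts" "D \<in> pol_obj elts"
  shows "pol_comp (pol_comp (associator A B D) (symmetry A (B \<odot> D))) (associator B D A) =
    pol_comp (pol_comp (symmetry A B \<boxdot> pol_id D) (associator B A D)) (pol_id B \<boxdot> symmetry A D)"
  using assms unfolding structural_defs
  by (simp add: multimap_calculus structural_continuity) (rule induced_cong, auto simp: neg_Pol_tensor)

lemma symmetric_monoidal_category_Pol:
  "symmetric_monoidal_category (Pol elts) (Pol_tensor elts) (Pol_tensor_arrow elts) (Pol_unit elts)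
     associator left_unitor right_unitor symmetry"
proof (intro symmetric_monoidal_category.intro monoidal_category.intro category_Pol
    monoidal_category_axioms.intro symmetric_monoidal_category_axioms.intro, unfold Pol_sel)
  show "f \<boxdot> g \<in> Hom (Pol elts) (A \<odot> A') (B \<odot> B')"
    if "f \<in> Hom (Pol elts) A B" "g \<in> Hom (Pol elts) A' B'" for f A B g A' B'
    using that by (elim Hom_PolE) (simp add: multimap_calculus induced_Hom)
  show "pol_id A \<boxdot> pol_id B = pol_id (A \<odot> B)"
    if "A \<in> pol_obj elts" "B \<in> pol_obj elts" for A B
    using that by (simp add: multimap_calculus) (rule induced_cong, auto simp: neg_Pol_tensor)
  show "symmetry A B \<in> Hom (Pol elts) (A \<odot> B) (B \<odot> A)"
    if "A \<in> pol_obj elts" "B \<in> pol_obj elts" for A B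
    using that by (simp add: symmetry_def induced_Hom Pol_tensor_obj continuous_swap)
  show "pol_comp (symmetry A B) (symmetry B A) = pol_id (A \<odot> B)"
    if "A \<in> pol_obj elts" "B \<in> pol_obj elts" for A B
    using that unfolding symmetry_def
    by (simp add: multimap_calculus structural_continuity) (rule induced_cong, auto simp: neg_Pol_tensor)
  show "pol_comp (symmetry A (Pol_unit elts)) (left_unitor A) = right_unitor A"
    if "A \<in> pol_obj elts" for A
    using that unfolding structural_defs
    by (simp add: multimap_calculus structural_continuity Pol_unit_obj)
      (rule induced_cong, auto simp: neg_Pol_tensor)
qed (fact Pol_tensor_obj Pol_unit_obj tensor_arrow_comp associator_iso unitor_isos associator_natural
    unitors_natural symmetry_natural pentagon_Pol triangle_Pol hexagon_Pol)+


section \<open>Star-autonomy\<close>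

text \<open>Points of \<open>A \<otimes> B\<close> and of \<open>B \<otimes> D\<close> are encoded pairs, so changing the brackets of a triple has to recode them.\<close>

definition transpose_arrow ::
  "('v, 'v) polarity \<Rightarrow> ('v, 'v) polarity \<Rightarrow> ('v, 'v) polarity \<Rightarrow> ('v, 'v, 'v, 'v) pol_arrow
    \<Rightarrow> ('v, 'v, 'v, 'v) pol_arrow" where
  "transpose_arrow A B D k = \<lparr>source = A, target = dual (B \<odot> D),
     rel = {(a, x). \<exists>b d. x = pair b d \<and> (pair a b, d) \<in> rel k}\<rparr>"

definition untranspose_arrow ::
  "('v, 'v) polarity \<Rightarrow> ('v, 'v) polarity \<Rightarrow> ('v, 'v) polarity \<Rightarrow> ('v, 'v, 'v, 'v) pol_arrow
    \<Rightarrow> ('v, 'v, 'v, 'v) pol_arrow" where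
  "untranspose_arrow A B D l = \<lparr>source = A \<odot> B, target = dual D,
     rel = {(x, d). \<exists>a b. x = pair a b \<and> (a, pair b d) \<in> rel l}\<rparr>"

text \<open>The right-hand sides of the next two equivalences differ only in the brackets.\<close>

lemma compatible_from_tensor:
  assumes "A \<in> pol_obj elts" "B \<in> pol_obj elts"
  shows "compatible (A \<odot> B) (dual D) R \<longleftrightarrow> R \<subseteq> neg (A \<odot> B) \<times> neg D \<and>
    (\<forall>b \<in> neg B. \<forall>d \<in> neg D. closed_set A {a \<in> neg A. (pair a b, d) \<in> R}) \<and>
    (\<forall>a \<in> neg A. \<forall>d \<in> neg D. closed_set B {b \<in> neg B. (pair a b, d) \<in> R}) \<and>
    (\<forall>a \<in> neg A. \<forall>b \<in> neg B. closed_set D {d \<in> neg D. (pair a b, d) \<in> R})"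
  by (simp add: compatible_iff closed_set_Pol_tensor assms) blast

lemma compatible_to_dual_tensor:
  assumes "B \<in> pol_obj elts" "D \<in> pol_obj elts"
  shows "compatible A (dual (B \<odot> D)) R \<longleftrightarrow> R \<subseteq> neg A \<times> neg (B \<odot> D) \<and>
    (\<forall>b \<in> neg B. \<forall>d \<in> neg D. closed_set A {a \<in> neg A. (a, pair b d) \<in> R}) \<and>
    (\<forall>a \<in> neg A. \<forall>d \<in> neg D. closed_set B {b \<in> neg B. (a, pair b d) \<in> R}) \<and>
    (\<forall>a \<in> neg A. \<forall>b \<in> neg B. closed_set D {d \<in> neg D. (a, pair b d) \<in> R})"
  by (simp add: compatible_iff closed_set_Pol_tensor assms) blast

lemma transpose_bij:
  assumes obj: "A \<in> pol_obj elts" "B \<in> pol_obj elts" "D \<in> pol_obj elts"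
  shows "bij_betw (transpose_arrow A B D) (Hom (Pol elts) (A \<odot> B) (dual D)) (Hom (Pol elts) A (dual (B \<odot> D)))"
proof (rule bij_betw_byWitness[where f' = "untranspose_arrow A B D"])
  have left: "k \<in> Hom (Pol elts) (A \<odot> B) (dual D) \<longleftrightarrow>
      compatible (A \<odot> B) (dual D) (rel k) \<and> source k = A \<odot> B \<and> target k = dual D" for k
    using obj by (auto simp: Hom_Pol_iff pol_arrow_def dual_obj Pol_tensor_obj polarity_pol_obj)
  have right: "l \<in> Hom (Pol elts) A (dual (B \<odot> D)) \<longleftrightarrow>
      compatible A (dual (B \<odot> D)) (rel l) \<and> source l = A \<and> target l = dual (B \<odot> D)" for l
    using obj by (auto simp: Hom_Pol_iff pol_arrow_def dual_obj Pol_tensor_obj polarity_pol_obj)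
  show "\<forall>k \<in> Hom (Pol elts) (A \<odot> B) (dual D). untranspose_arrow A B D (transpose_arrow A B D k) = k"
  proof
    fix k assume k: "k \<in> Hom (Pol elts) (A \<odot> B) (dual D)"
    then have "rel k \<subseteq> neg (A \<odot> B) \<times> neg D" by (simp add: left compatible_iff)
    then have "rel (untranspose_arrow A B D (transpose_arrow A B D k)) = rel k"
      by (auto simp: transpose_arrow_def untranspose_arrow_def neg_Pol_tensor)
    then show "untranspose_arrow A B D (transpose_arrow A B D k) = k"
      using k by (simp add: left untranspose_arrow_def)
  qed
  show "\<forall>l \<in> Hom (Pol elts) A (dual (B \<odot> D)). transpose_arrow A B D (untranspose_arrow A B D l) = l"
  proof
    fix l assume l: "l \<in> Hom (Pol elts) A (dual (B \<odot> D))"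
    then have "rel l \<subseteq> neg A \<times> neg (B \<odot> D)" by (simp add: right compatible_iff)
    then have "rel (transpose_arrow A B D (untranspose_arrow A B D l)) = rel l"
      by (auto simp: transpose_arrow_def untranspose_arrow_def neg_Pol_tensor)
    then show "transpose_arrow A B D (untranspose_arrow A B D l) = l"
      using l by (simp add: right transpose_arrow_def)
  qed
  show "transpose_arrow A B D ` Hom (Pol elts) (A \<odot> B) (dual D) \<subseteq> Hom (Pol elts) A (dual (B \<odot> D))"
  proof (rule image_subsetI)
    fix k assume "k \<in> Hom (Pol elts) (A \<odot> B) (dual D)"
    then have k: "compatible (A \<odot> B) (dual D) (rel k)" by (simp add: left)
    then have "rel k \<subseteq> neg (A \<odot> B) \<times> neg D" by (simp add: compatible_iff)
    then have "rel (transpose_arrow A B D k) \<subseteq> neg A \<times> neg (B \<odot> D)"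
      by (auto simp: transpose_arrow_def)
    then have "compatible A (dual (B \<odot> D)) (rel (transpose_arrow A B D k))"
      using k obj by (simp add: compatible_from_tensor compatible_to_dual_tensor transpose_arrow_def)
    then show "transpose_arrow A B D k \<in> Hom (Pol elts) A (dual (B \<odot> D))"
      by (simp add: right) (simp add: transpose_arrow_def)
  qed
  show "untranspose_arrow A B D ` Hom (Pol elts) A (dual (B \<odot> D)) \<subseteq> Hom (Pol elts) (A \<odot> B) (dual D)"
  proof (rule image_subsetI)
    fix l assume "l \<in> Hom (Pol elts) A (dual (B \<odot> D))"
    then have l: "compatible A (dual (B \<odot> D)) (rel l)" by (simp add: right)
    then have "rel l \<subseteq> neg A \<times> neg (B \<odot> D)" by (simp add: compatible_iff)
    then have "rel (untranspose_arrow A B D l) \<subseteq> neg (A \<odot> B) \<times> neg D"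
      by (auto simp: untranspose_arrow_def)
    then have "compatible (A \<odot> B) (dual D) (rel (untranspose_arrow A B D l))"
      using l obj by (simp add: compatible_from_tensor compatible_to_dual_tensor untranspose_arrow_def)
    then show "untranspose_arrow A B D l \<in> Hom (Pol elts) (A \<odot> B) (dual D)"
      by (simp add: left) (simp add: untranspose_arrow_def)
  qed
qed

text \<open>The form in which both sides of the naturality equation below arise, once with \<open>F\<close> and once with \<open>H\<close> a product
multimap.\<close>

lemma comp_induced_dual_induced:
  assumes F: "continuous_multimap A' A F" and H: "continuous_multimap D' D H"
    and pol: "polarity A'" "polarity A" "polarity D'" "polarity D"
    and k: "pol_arrow k" "source k = A" "target k = dual D"
  shows "pol_comp (pol_comp (induced A' A F) k) (dual_arrow (induced D' D H)) =
    \<lparr>source = A', target = dual D',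
     rel = {(a, d). a \<in> neg A' \<and> d \<in> neg D' \<and> F a \<times> H d \<subseteq> rel k}\<rparr>"
proof -
  have FH: "\<And>a. a \<in> neg A' \<Longrightarrow> F a \<subseteq> neg A" "\<And>d. d \<in> neg D' \<Longrightarrow> H d \<subseteq> neg D"
    using F H by (simp_all add: continuous_multimap_def)
  let ?l = "pol_comp (induced A' A F) k"
  have l: "?l = \<lparr>source = A', target = dual D,
      rel = {(a, d). a \<in> neg A' \<and> d \<in> neg D \<and> (\<forall>b \<in> F a. (b, d) \<in> rel k)}\<rparr>"
    using pol_comp_induced[OF FH(1) k(1,2)] k(3) by simp
  have "pol_arrow ?l"
    by (rule pol_arrow_comp) (simp_all add: k pol_arrow_induced pol F)
  then have "pol_comp ?l (dual_arrow (induced D' D H)) = \<lparr>source = source ?l, target = dual D',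
      rel = {(a, d'). a \<in> neg (source ?l) \<and> d' \<in> neg D' \<and> (\<forall>d \<in> H d'. (a, d) \<in> rel ?l)}\<rparr>"
    by (intro pol_comp_dual_induced H pol) (simp_all add: l)
  also have "\<dots> = \<lparr>source = A', target = dual D',
     rel = {(a, d). a \<in> neg A' \<and> d \<in> neg D' \<and> F a \<times> H d \<subseteq> rel k}\<rparr>"
    using FH(2) by (auto simp: l)
  finally show ?thesis .
qed

lemma transpose_natural:
  assumes "f \<in> Hom (Pol elts) A' A" "g \<in> Hom (Pol elts) B' B" "h \<in> Hom (Pol elts) D' D"
    and k: "k \<in> Hom (Pol elts) (A \<odot> B) (dual D)"
  shows "transpose_arrow A' B' D' (pol_comp (pol_comp (f \<boxdot> g) k) (dual_arrow h)) =
    pol_comp (pol_comp f (transpose_arrow A B D k)) (dual_arrow (g \<boxdot> h))"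
proof -
  obtain F G H where obj: "A \<in> pol_obj elts" "B \<in> pol_obj elts" "D \<in> pol_obj elts"
      "A' \<in> pol_obj elts" "B' \<in> pol_obj elts" "D' \<in> pol_obj elts"
    and F: "continuous_multimap A' A F" "f = induced A' A F"
    and G: "continuous_multimap B' B G" "g = induced B' B G"
    and H: "continuous_multimap D' D H" "h = induced D' D H"
    using assms by (elim Hom_PolE) blast
  let ?l = "transpose_arrow A B D k"
  have "?l \<in> Hom (Pol elts) A (dual (B \<odot> D))"
    using bij_betwE[OF transpose_bij[OF obj(1-3)]] k by blast
  then have l: "pol_arrow ?l" "source ?l = A" "target ?l = dual (B \<odot> D)"
    by (simp_all add: Hom_Pol_iff)
  have k': "pol_arrow k" "source k = A \<odot> B" "target k = dual D"
    using k by (simp_all add: Hom_Pol_iff)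
  have 1: "pol_comp (pol_comp (f \<boxdot> g) k) (dual_arrow h) = \<lparr>source = A' \<odot> B', target = dual D',
     rel = {(x, d). x \<in> neg (A' \<odot> B') \<and> d \<in> neg D' \<and> multimap_prod F G x \<times> H d \<subseteq> rel k}\<rparr>"
    unfolding F(2) G(2) H(2) Pol_tensor_arrow_induced[OF F(1) G(1) obj(4,1,5,2)]
    by (intro comp_induced_dual_induced continuous_multimap_prod F G H obj k' polarity_pol_obj Pol_tensor_obj)
  have 2: "pol_comp (pol_comp f ?l) (dual_arrow (g \<boxdot> h)) = \<lparr>source = A', target = dual (B' \<odot> D'),
     rel = {(a, y). a \<in> neg A' \<and> y \<in> neg (B' \<odot> D') \<and> F a \<times> multimap_prod G H y \<subseteq> rel ?l}\<rparr>"
    unfolding F(2) G(2) H(2) Pol_tensor_arrow_induced[OF G(1) H(1) obj(5,2,6,3)]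
    by (intro comp_induced_dual_induced continuous_multimap_prod F G H obj l polarity_pol_obj Pol_tensor_obj)
  have "multimap_prod F G (pair a b) \<times> H d \<subseteq> rel k \<longleftrightarrow>
      F a \<times> multimap_prod G H (pair b d) \<subseteq> rel ?l" for a b d
  proof -
    have "multimap_prod F G (pair a b) \<times> H d \<subseteq> rel k \<longleftrightarrow>
        (\<forall>a' \<in> F a. \<forall>b' \<in> G b. \<forall>d' \<in> H d. (pair a' b', d') \<in> rel k)"
      unfolding multimap_prod_pair by blast
    also have "\<dots> \<longleftrightarrow> (\<forall>a' \<in> F a. \<forall>b' \<in> G b. \<forall>d' \<in> H d. (a', pair b' d') \<in> rel ?l)"
      by (simp add: transpose_arrow_def)
    also have "\<dots> \<longleftrightarrow> F a \<times> multimap_prod G H (pair b d) \<subseteq> rel ?l"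
      unfolding multimap_prod_pair by blast
    finally show ?thesis .
  qed
  then show ?thesis
    unfolding 1 2 by (subst transpose_arrow_def) (auto simp: neg_Pol_tensor simp del: multimap_prod_pair)
qed

lemma star_autonomous_category_Pol:
  "star_autonomous_category (Pol elts) (Pol_tensor elts) (Pol_tensor_arrow elts) (Pol_unit elts)
     associator left_unitor right_unitor symmetry dual dual_arrow transpose_arrow"
  by (intro star_autonomous_category.intro symmetric_monoidal_category_Pol
      contravariant_endofunctor_Pol star_autonomous_category_axioms.intro)
    (simp_all add: transpose_bij transpose_natural)

end

theorem theorem7p2:
  fixes elts :: "'v \<Rightarrow> 'v set"
  assumes "set_universe elts"
  shows "\<exists>ass lun run sym phi.
    star_autonomous_category (Pol elts) (Pol_tensor elts) (Pol_tensor_arrow elts) (Pol_unit elts)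
      ass lun run sym dual dual_arrow phi"
  using set_universe.star_autonomous_category_Pol[OF assms] by blast

end
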